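(* Let $r\ge1$. Let $\overline{A}(\ell_1,\dots,\ell_r;k,n)$ be the number of overpartitions of $n$ into non-negative parts, each coloured by one of the primary colours $u_1,\dots,u_r$, having exactly $\ell_i$ parts coloured $u_i$ for each $i$ and exactly $k$ non-overlined parts. Let $\overline{B}(\ell_1,\dots,\ell_r;k,n)$ be the number of finite sequences $\lambda_1,\dots,\lambda_s$ of non-negative integers, each coloured by one of $\tilde u_1,\dots,\tilde u_{2^r-1}$ and each possibly overlined, with $\sum\lambda_i=n$, such that for each $i\in\{1,\dots,r\}$ exactly $\ell_i$ parts have $u_i$ among their primary colours, exactly $k$ parts are non-overlined, and for all $1\le i<s$ $$\lambda_i-\lambda_{i+1}\ge w(c(\lambda_{i+1}))+\chi(\overline{\lambda_{i+1}})-1+\delta(c(\lambda_i),c(\lambda_{i+1})),$$ where $c(\lambda)$ is the colour of $\lambda$ and $\chi(\overline{\lambda_{i+1}})=1$ if $\lambda_{i+1}$ is overlined and $0$ otherwise. Then $\overline{A}(\ell_1,\dots,\ell_r;k,n)=\overline{B}(\ell_1,\dots,\ell_r;k,n)$ for all $\ell_1,\dots,\ell_r,k,n\ge0$.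
   Context: An overpartition with coloured parts is a finite multiset of coloured non-negative integers, some of which are overlined, such that for each colour and each integer value at most one part of that colour and value is overlined (non-overlined parts may repeat). Primary colours $u_1<\dots<u_r$. For $i\in\{1,\dots,2^r-1\}$, $\tilde u_i:=u_1^{\epsilon_1(i)}\cdots u_r^{\epsilon_r(i)}$ where $\epsilon_k(i)=1$ if $2^{k-1}$ appears in the binary expansion of $i$ and $0$ otherwise; "$u_j$ is a primary colour of $\tilde u_i$" means $\epsilon_j(i)=1$. For a colour $\tilde u_i$: $v(\tilde u_i)$ (resp. $z(\tilde u_i)$) is the smallest (resp. largest) primary colour appearing in $\tilde u_i$, and $w(\tilde u_i)$ is the number of primary colours appearing in it. $\delta(\tilde u_i,\tilde u_j)=1$ if $z(\tilde u_i)<v(\tilde u_j)$ (in the order $u_1<\dots<u_r$), and $0$ otherwise. *)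

theory Defs
  imports Main "HOL-Library.Multiset"
begin

text \<open>A coloured (possibly overlined) part is a triple (value, colour, overlined).
  Primary colours u_1..u_r are encoded by indices 1..r; the colours
  tilde u_i (1 <= i <= 2^r - 1) are encoded by the index i.\<close>

type_synonym cpart = "nat \<times> nat \<times> bool"

definition part_val :: "cpart \<Rightarrow> nat" where "part_val p = fst p"
definition part_col :: "cpart \<Rightarrow> nat" where "part_col p = fst (snd p)"
definition part_ovl :: "cpart \<Rightarrow> bool" where "part_ovl p = snd (snd p)"

text \<open>epsilon_j(i) = 1, i.e. u_j is a primary colour of tilde u_i.\<close>
definition eps :: "nat \<Rightarrow> nat \<Rightarrow> bool" where
  "eps j i \<longleftrightarrow> odd (i div 2 ^ (j - 1))"

definition prim_cols :: "nat \<Rightarrow> nat \<Rightarrow> nat set" where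
  "prim_cols r i = {j \<in> {1..r}. eps j i}"

definition wcol :: "nat \<Rightarrow> nat \<Rightarrow> nat" where "wcol r i = card (prim_cols r i)"
definition vcol :: "nat \<Rightarrow> nat \<Rightarrow> nat" where "vcol r i = Min (prim_cols r i)"
definition zcol :: "nat \<Rightarrow> nat \<Rightarrow> nat" where "zcol r i = Max (prim_cols r i)"
definition delta :: "nat \<Rightarrow> nat \<Rightarrow> nat \<Rightarrow> int" where
  "delta r i i' = (if zcol r i < vcol r i' then 1 else 0)"

definition Abar :: "nat \<Rightarrow> (nat \<Rightarrow> nat) \<Rightarrow> nat \<Rightarrow> nat \<Rightarrow> nat" where
  "Abar r l k n = card {M :: cpart multiset.
      (\<forall>p \<in># M. part_col p \<in> {1..r})
    \<and> (\<forall>v c. count M (v, c, True) \<le> 1)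
    \<and> sum_mset (image_mset part_val M) = n
    \<and> (\<forall>i \<in> {1..r}. size (filter_mset (\<lambda>p. part_col p = i) M) = l i)
    \<and> size (filter_mset (\<lambda>p. \<not> part_ovl p) M) = k}"

definition Bbar :: "nat \<Rightarrow> (nat \<Rightarrow> nat) \<Rightarrow> nat \<Rightarrow> nat \<Rightarrow> nat" where
  "Bbar r l k n = card {xs :: cpart list.
      (\<forall>p \<in> set xs. part_col p \<in> {1..2 ^ r - 1})
    \<and> sum_list (map part_val xs) = n
    \<and> (\<forall>i \<in> {1..r}. length (filter (\<lambda>p. eps i (part_col p)) xs) = l i)
    \<and> length (filter (\<lambda>p. \<not> part_ovl p) xs) = k
    \<and> (\<forall>i. i + 1 < length xs \<longrightarrow>
          int (part_val (xs ! i)) - int (part_val (xs ! (i + 1)))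
            \<ge> int (wcol r (part_col (xs ! (i + 1))))
              + (if part_ovl (xs ! (i + 1)) then 1 else 0) - 1
              + delta r (part_col (xs ! i)) (part_col (xs ! (i + 1))))}"

end

theory Submission
  imports Defs "HOL-Library.Function_Algebras"
begin

text \<open>
  Let \<open>a m\<close> be the generating function, in variables \<open>u\<^sub>1, \<dots>, u\<^sub>r, d, q\<close>, of the sequences
  counted by \<open>Bbar\<close> whose last part is at least \<open>m\<close>, and consider the operators \<open>S\<close> (\<open>m\<close> becomes
  \<open>m + 1\<close>), \<open>X\<close> (multiplication by \<open>q ^ m\<close>), \<open>Y = X (d + S)\<close> and \<open>L = S - Y\<close>.  Removing the last
  part gives relations which collapse to the single equation \<open>P a = S (1 + Q) a\<close> with
  \<open>P = \<Prod>\<^sub>j (1 + u\<^sub>j L)\<close> and \<open>Q = (P - 1) / L\<close>.  Because \<open>S L = q L S + (1 - q) S S\<close>, the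
  series \<open>P a\<close> solves the same equation with each \<open>u\<^sub>j\<close> replaced by \<open>q u\<^sub>j\<close>; solutions are
  unique up to normalisation, so \<open>P a = \<Prod>\<^sub>j (1 + u\<^sub>j) \<cdot> a(u q)\<close>.  At \<open>m = 0\<close> the operator \<open>L\<close> acts as
  multiplication by \<open>-d\<close>, hence \<open>\<Prod>\<^sub>j (1 - d u\<^sub>j) \<cdot> a = \<Prod>\<^sub>j (1 + u\<^sub>j) \<cdot> a(u q)\<close> there, which is the
  functional equation that characterises the generating function of overpartitions.
\<close>

section \<open>Exponent vectors and monomial multiplication on power series\<close>

text \<open>A weight is an exponent vector: \<open>Prim j\<close> is the exponent of \<open>u\<close> with index \<open>j + 1\<close>, \<open>Plain\<close> that of
  \<open>d\<close> (non-overlined parts) and \<open>Size\<close> that of \<open>q\<close>.\<close>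

datatype stat = Prim nat | Plain | Size

type_synonym weight = "stat \<Rightarrow> nat"
type_synonym series = "nat \<Rightarrow> weight \<Rightarrow> int"

definition unit_weight :: "stat \<Rightarrow> weight" where
  "unit_weight s = (\<lambda>t. if t = s then 1 else 0)"

definition deg :: "nat \<Rightarrow> weight \<Rightarrow> nat" where
  "deg r x = (\<Sum>j<r. x (Prim j))"

lemma deg_add: "deg r (x + y) = deg r x + deg r y"
  by (simp add: deg_def sum.distrib)

text \<open>A function on weights is read as the coefficients of a power series; this is
  multiplication by the monomial with exponents \<open>w\<close>. The case distinction guards the
  truncated subtraction.\<close>

definition shift :: "weight \<Rightarrow> (weight \<Rightarrow> int) \<Rightarrow> weight \<Rightarrow> int" where
  "shift w f x = (if \<forall>s. w s \<le> x s then f (\<lambda>s. x s - w s) else 0)"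

lemma shift_shift: "shift v (shift w f) = shift (v + w) f"
proof
  fix x
  have "(\<forall>s. v s \<le> x s) \<and> (\<forall>s. w s \<le> x s - v s) \<longleftrightarrow> (\<forall>s. (v + w) s \<le> x s)"
    by (auto simp: add.commute le_diff_conv2) (metis add_leE le_diff_conv2 add.commute)+
  then show "shift v (shift w f) x = shift (v + w) f x"
    by (auto simp: shift_def)
qed

lemma shift_0: "shift (\<lambda>s. 0) f = f"
  by (auto simp: shift_def fun_eq_iff)

lemma shift_add: "shift w (f + g) = shift w f + shift w g"
  by (auto simp: shift_def fun_eq_iff)

section \<open>Additive operators on series\<close>

text \<open>Additive maps form a noncommutative ring. As a type of class \<open>ring_1\<close>, they
  let operator identities be computed by ordinary ring simplification, with the commutation rules as
  the only special facts.\<close>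

typedef oper = "{T :: series \<Rightarrow> series. \<forall>f g. T (f + g) = T f + T g}"
  morphisms app Oper
  by (rule exI[of _ "\<lambda>f. f"]) simp

setup_lifting type_definition_oper

instantiation oper :: ring_1
begin

lift_definition zero_oper :: oper is "\<lambda>f. 0" by simp
lift_definition one_oper :: oper is "\<lambda>f. f" by simp
lift_definition plus_oper :: "oper \<Rightarrow> oper \<Rightarrow> oper" is "\<lambda>T U f. T f + U f"
  by (simp add: algebra_simps)
lift_definition minus_oper :: "oper \<Rightarrow> oper \<Rightarrow> oper" is "\<lambda>T U f. T f - U f"
  by (simp add: algebra_simps)
lift_definition uminus_oper :: "oper \<Rightarrow> oper" is "\<lambda>T f. - T f"
  by (simp add: algebra_simps)
lift_definition times_oper :: "oper \<Rightarrow> oper \<Rightarrow> oper" is "\<lambda>T U f. T (U f)"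
  by simp

instance
proof
  show "(0::oper) \<noteq> 1"
  proof transfer
    have "(0 :: series) \<noteq> 1" by (simp add: fun_eq_iff)
    then show "(\<lambda>f. 0) \<noteq> (\<lambda>f::series. f)" by metis
  qed
qed (transfer; simp add: algebra_simps fun_eq_iff)+

end

lemma app_simps [simp]:
  "app 0 f = 0" "app 1 f = f" "app (T + U) f = app T f + app U f"
  "app (T - U) f = app T f - app U f" "app (- T) f = - app T f"
  "app (T * U) f = app T (app U f)"
  by (transfer; simp)+

lemma app_add: "app T (f + g) = app T f + app T g"
  by transfer simp

lemma app_zero [simp]: "app T 0 = 0"
  using app_add[of T 0 0] by simp

lemma app_diff: "app T (f - g) = app T f - app T g"
  using app_add[of T "f - g" g] by simp

lemma app_sum: "app T (\<Sum>i\<in>I. f i) = (\<Sum>i\<in>I. app T (f i))"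
  by (induction I rule: infinite_finite_induct) (simp_all only: sum.infinite sum.empty sum.insert app_zero app_add not_False_eq_True)

lift_definition mono_op :: "weight \<Rightarrow> oper" is "\<lambda>w f m. shift w (f m)"
  by (auto simp: shift_add fun_eq_iff)

lift_definition S_op :: oper is "\<lambda>f m. f (Suc m)"
  by (auto simp: fun_eq_iff)

lift_definition X_op :: oper is "\<lambda>f m. shift (\<lambda>s. if s = Size then m else 0) (f m)"
  by (auto simp: shift_add fun_eq_iff)

text \<open>The substitution of \<open>q u\<close> for each of the first \<open>r\<close> variables \<open>u\<close>.\<close>

lift_definition sigma_op :: "nat \<Rightarrow> oper"
  is "\<lambda>r f m x. if deg r x \<le> x Size then f m (x(Size := x Size - deg r x)) else 0"
  by (auto simp: fun_eq_iff)

lemma mono_op_mult: "mono_op v * mono_op w = mono_op (v + w)"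
  by transfer (simp add: shift_shift)

lemma mono_op_commute: "mono_op v * mono_op w = mono_op w * mono_op v"
  by (simp add: mono_op_mult add.commute)

lemma mono_op_S: "mono_op w * S_op = S_op * mono_op w"
  by transfer simp

lemma mono_op_X: "mono_op w * X_op = X_op * mono_op w"
  by transfer (simp only: shift_shift add.commute[of "\<lambda>s. if s = Size then _ else 0"])

abbreviation q_op :: oper where "q_op \<equiv> mono_op (unit_weight Size)"
abbreviation d_op :: oper where "d_op \<equiv> mono_op (unit_weight Plain)"
abbreviation u_op :: "nat \<Rightarrow> oper" where "u_op j \<equiv> mono_op (unit_weight (Prim j))"

text \<open>Passing to \<open>m + 1\<close> turns \<open>q ^ m\<close> into
  \<open>q * q ^ m\<close>; this extra \<open>q\<close> is the source of the twist.\<close>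

lemma S_X: "S_op * X_op = q_op * X_op * S_op"
proof -
  have "(\<lambda>s. if s = Size then Suc m else 0) = unit_weight Size + (\<lambda>s. if s = Size then m else 0)" for m
    by (auto simp: unit_weight_def)
  then show ?thesis by transfer (simp add: shift_shift)
qed

lemma sigma_S: "sigma_op r * S_op = S_op * sigma_op r"
  by transfer simp

text \<open>Replacing \<open>u\<close> by \<open>q u\<close> multiplies the monomial
  \<open>w\<close> by one \<open>q\<close> for each factor \<open>u\<close>. Here \<open>sg\<close>
  is \<open>sigma_op\<close> at a fixed \<open>m\<close>.\<close>

lemma sigma_shift:
  fixes f :: "weight \<Rightarrow> int" and r :: nat
  defines "sg \<equiv> \<lambda>f x. if deg r x \<le> x Size then f (x(Size := x Size - deg r x)) else (0::int)"
  shows "sg (shift w f) = shift (w(Size := w Size + deg r w)) (sg f)"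
proof
  fix x
  let ?w = "w(Size := w Size + deg r w)" and ?x = "x(Size := x Size - deg r x)"
  have D: "deg r (\<lambda>s. x s - ?w s) = deg r x - deg r w" "deg r w \<le> deg r x" if "\<forall>s. s \<noteq> Size \<longrightarrow> w s \<le> x s"
  proof -
    have "deg r (\<lambda>s. x s - ?w s) + deg r w = deg r x"
      using that by (auto simp: deg_def simp flip: sum.distrib intro!: sum.cong)
    then show "deg r (\<lambda>s. x s - ?w s) = deg r x - deg r w" "deg r w \<le> deg r x" by auto
  qed
  show "sg (shift w f) x = shift ?w (sg f) x"
  proof (cases "\<forall>s. s \<noteq> Size \<longrightarrow> w s \<le> x s")
    case True
    have 1: "(\<forall>s. w s \<le> ?x s) \<longleftrightarrow> w Size \<le> x Size - deg r x" "(\<forall>s. ?w s \<le> x s) \<longleftrightarrow> w Size + deg r w \<le> x Size"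
      using True by (auto split: if_splits)
    have 2: "(\<lambda>s. ?x s - w s) = (\<lambda>s. x s - ?w s)(Size := x Size - ?w Size - (deg r x - deg r w))"
      using D(2)[OF True] by (auto simp: fun_eq_iff)
    show ?thesis
    proof (cases "w Size + deg r x \<le> x Size")
      case T: True
      then have "deg r x \<le> x Size" "w Size \<le> x Size - deg r x" "w Size + deg r w \<le> x Size"
        "deg r x - deg r w \<le> x Size - ?w Size"
        using D(2)[OF True] by auto
      then show ?thesis
        unfolding sg_def shift_def 1 D(1)[OF True] by (simp only: if_True 2)
    next
      case F: False
      then have "\<not> (deg r x \<le> x Size \<and> w Size \<le> x Size - deg r x)"
        "\<not> (w Size + deg r w \<le> x Size \<and> deg r x - deg r w \<le> x Size - ?w Size)"
        using D(2)[OF True] by auto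
      then show ?thesis
        unfolding sg_def shift_def 1 D(1)[OF True] by auto
    qed
  next
    case False
    then have "\<not> (\<forall>s. w s \<le> ?x s)" "\<not> (\<forall>s. ?w s \<le> x s)" by auto
    then show ?thesis by (simp only: sg_def shift_def if_False if_cancel)
  qed
qed

lemma sigma_mono: "sigma_op r * mono_op w = mono_op (w(Size := w Size + deg r w)) * sigma_op r"
  by transfer (intro ext, rule sigma_shift[THEN fun_cong])

lemma sigma_X: "sigma_op r * X_op = X_op * sigma_op r"
proof -
  have "(\<lambda>s. if s = Size then m else 0)(Size := (\<lambda>s. if s = Size then m else 0) Size
      + deg r (\<lambda>s. if s = Size then m else 0)) = (\<lambda>s. if s = Size then m else 0)" for m r
    by (auto simp: deg_def)
  note eq = this
  show ?thesis
    by transfer (intro ext, subst sigma_shift[THEN fun_cong], simp only: eq)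
qed

section \<open>Products of commuting linear factors\<close>

primrec prod_op :: "(nat \<Rightarrow> 'e::ring_1) \<Rightarrow> 'e \<Rightarrow> nat \<Rightarrow> 'e" where
  "prod_op u L 0 = 1"
| "prod_op u L (Suc i) = prod_op u L i * (1 + u i * L)"

text \<open>\<open>(P - 1) / L\<close> without division: \<open>prod_op\<close> grows by
  \<open>u i * P * L\<close> at each step, up to commutation, so the quotient grows by
  \<open>u i * P\<close>.\<close>

primrec quot_op :: "(nat \<Rightarrow> 'e::ring_1) \<Rightarrow> 'e \<Rightarrow> nat \<Rightarrow> 'e" where
  "quot_op u L 0 = 0"
| "quot_op u L (Suc i) = quot_op u L i + u i * prod_op u L i"

lemma prod_op_commute:
  assumes "\<And>i. u i * z = z * u i" "L * z = z * L"
  shows "prod_op u L n * z = z * prod_op u L n"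
proof (induction n)
  case (Suc n)
  have "u n * L * z = z * (u n * L)" by (metis assms mult.assoc)
  then have "(1 + u n * L) * z = z * (1 + u n * L)" by (simp add: algebra_simps)
  then show ?case using Suc by (metis mult.assoc prod_op.simps(2))
qed simp

lemma quot_op_commute:
  assumes "\<And>i. u i * z = z * u i" "L * z = z * L"
  shows "quot_op u L n * z = z * quot_op u L n"
proof (induction n)
  case (Suc n)
  have "u n * prod_op u L n * z = z * (u n * prod_op u L n)"
    using prod_op_commute[of u z L n, OF assms] assms(1) by (metis mult.assoc)
  then show ?case using Suc by (simp add: algebra_simps)
qed simp


lemma prod_op_eq_quot_op:
  assumes uL: "\<And>i. u i * L = L * u i" and uu: "\<And>i j. u i * u j = u j * u i"
  shows "prod_op u L n = 1 + quot_op u L n * L"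
proof (induction n)
  case (Suc n)
  have "prod_op u L n * (u n * L) = u n * prod_op u L n * L"
    by (metis prod_op_commute[of u "u n" L n, OF uu uL[symmetric]] mult.assoc)
  then show ?case using Suc by (simp add: algebra_simps)
qed simp

text \<open>If \<open>S\<close> is invertible with inverse \<open>Z\<close>, the hypothesis reads \<open>L Z = q Z L + (1 - q)\<close>, whence
  \<open>f(L) Z = Z f(q L) + (f(L) - f(q L)) / L\<close> for polynomials \<open>f\<close>; this is that rule, freed of inverses.\<close>

lemma prod_op_twist:
  fixes u :: "nat \<Rightarrow> 'e::ring_1" and q S L :: 'e
  assumes uL: "\<And>i. u i * L = L * u i" and uu: "\<And>i j. u i * u j = u j * u i"
    and uS: "\<And>i. u i * S = S * u i" and uq: "\<And>i. u i * q = q * u i"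
    and qL: "q * L = L * q" and qS: "q * S = S * q"
    and SL: "S * L = q * L * S + (1 - q) * S * S"
  defines "u' \<equiv> \<lambda>i. q * u i"
  shows "S * prod_op u L n = prod_op u' L n * S + S * (quot_op u L n - quot_op u' L n) * S"
proof (induction n)
  case (Suc n)
  define P P' W where "P = prod_op u L n" and "P' = prod_op u' L n"
    and "W = quot_op u L n - quot_op u' L n"
  have u'L: "u' i * L = L * u' i" and u'u': "u' i * u' j = u' j * u' i" and u'q: "u' i * q = q * u' i"
    and u'u: "u' i * u j = u j * u' i" for i j
    unfolding u'_def by (metis mult.assoc uL uu uq qL)+
  have u'n: "u' n = q * u n" by (simp add: u'_def)
  have IH: "S * P = P' * S + S * W * S" using Suc by (simp add: P_def P'_def W_def)
  \<comment> \<open>Both products have the form \<open>1 + quot_op * L\<close>, so the constant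
    terms cancel.\<close>
  have WL: "W * L = P - P'"
    using prod_op_eq_quot_op[of u L n, OF uL uu] prod_op_eq_quot_op[of u' L n, OF u'L u'u']
    by (simp add: P_def P'_def W_def algebra_simps)
  have Pq: "P * q = q * P" "P' * q = q * P'" "W * q = q * W"
    unfolding P_def P'_def W_def
    using prod_op_commute[of u q L n, OF uq qL[symmetric]] prod_op_commute[of u' q L n, OF u'q qL[symmetric]]
      quot_op_commute[of u q L n, OF uq qL[symmetric]] quot_op_commute[of u' q L n, OF u'q qL[symmetric]]
    by (simp_all add: algebra_simps)
  have Pu: "P * u n = u n * P" "P' * u n = u n * P'"
    unfolding P_def P'_def
    using prod_op_commute[of u "u n" L n, OF uu uL[symmetric]] prod_op_commute[of u' "u n" L n, OF u'u uL[symmetric]]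
    by simp_all
  have qSa: "S * (q * z) = q * (S * z)" "P' * (q * z) = q * (P' * z)" "W * (q * z) = q * (W * z)" for z
    by (metis mult.assoc qS Pq)+
  have uSa: "S * (u n * z) = u n * (S * z)" "P' * (u n * z) = u n * (P' * z)"
      "P * (u n * z) = u n * (P * z)" "q * (u n * z) = u n * (q * z)" for z
    by (metis mult.assoc uS Pu uq)+
  have "S * P * L = P' * (S * L) + S * W * (S * L)"
    by (simp add: IH algebra_simps)
  also have "\<dots> = q * (P' * (L * S)) + P' * (S * S) - q * (P' * (S * S)) + q * (S * ((W * L) * S))
      + S * W * S * S - q * (S * W * S * S)"
    by (simp add: SL algebra_simps qSa)
  \<comment> \<open>The induction hypothesis is used backwards to eliminate \<open>W\<close> between
    two copies of \<open>S\<close>; together with \<open>WL\<close> no \<open>W\<close> is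
    left.\<close>
  also have "S * W * S = S * P - P' * S" by (simp add: IH)
  also have "q * (P' * (L * S)) + P' * (S * S) - q * (P' * (S * S)) + q * (S * ((W * L) * S))
      + (S * P - P' * S) * S - q * ((S * P - P' * S) * S)
    = q * (P' * (L * S)) + S * (P * S) - q * (S * (P' * S))"
    by (simp add: WL algebra_simps)
  finally have *: "S * (P * L) = q * (P' * (L * S)) + S * (P * S) - q * (S * (P' * S))"
    by (simp add: mult.assoc)
  have "S * prod_op u L (Suc n) = S * P + u n * (S * (P * L))"
    by (simp add: P_def[symmetric] algebra_simps uSa)
  also have "\<dots> = prod_op u' L (Suc n) * S + S * (quot_op u L (Suc n) - quot_op u' L (Suc n)) * S"
    unfolding * IH by (simp add: P_def[symmetric] P'_def[symmetric] algebra_simps uSa W_def u'n qSa)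
  finally show ?case .
qed simp

section \<open>The operators \<open>Y_op\<close> and \<open>L_op\<close> and their commutation
  rules\<close>

lemma u_op_commute: "u_op i * u_op j = u_op j * u_op i"
  by (rule mono_op_commute)

text \<open>The contribution of a last part of value \<open>m\<close>, apart from its colour:
  \<open>X_op\<close> records the value, \<open>d_op\<close> is the non-overlined case, and
  \<open>S_op\<close> the overlined one, where the bound for the next part rises by one.\<close>

definition Y_op :: oper where "Y_op = X_op * (d_op + S_op)"
definition L_op :: oper where "L_op = S_op - Y_op"

lemma mono_op_Y: "mono_op w * Y_op = Y_op * mono_op w"
proof -
  have "mono_op w * (d_op + S_op) = (d_op + S_op) * mono_op w"
    by (simp add: algebra_simps mono_op_S mono_op_commute[of w])
  then show ?thesis unfolding Y_op_def by (metis mono_op_X mult.assoc)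
qed

lemma mono_op_L: "mono_op w * L_op = L_op * mono_op w"
  by (simp add: L_op_def algebra_simps mono_op_Y mono_op_S)

text \<open>Moving \<open>S_op\<close> past \<open>X_op\<close> gives \<open>Y_op\<close> a factor
  \<open>q_op\<close>; writing \<open>Y_op\<close> as \<open>S_op - L_op\<close> then produces the
  second summand.\<close>

lemma S_L: "S_op * L_op = q_op * L_op * S_op + (1 - q_op) * S_op * S_op"
proof -
  have "S_op * Y_op = q_op * Y_op * S_op"
  proof -
    have "S_op * Y_op = q_op * X_op * (S_op * (d_op + S_op))"
      by (simp add: Y_op_def S_X flip: mult.assoc)
    also have "S_op * (d_op + S_op) = (d_op + S_op) * S_op"
      by (simp add: algebra_simps mono_op_S)
    finally show ?thesis by (simp add: Y_op_def mult.assoc)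
  qed
  then show ?thesis by (simp add: L_op_def algebra_simps)
qed

lemma sigma_L: "sigma_op r * L_op = L_op * sigma_op r"
proof -
  have "sigma_op r * d_op = d_op * sigma_op r"
    unfolding sigma_mono by (rule arg_cong[where f = "\<lambda>w. mono_op w * _"]) (auto simp: unit_weight_def deg_def)
  then have "sigma_op r * (d_op + S_op) = (d_op + S_op) * sigma_op r"
    by (simp add: algebra_simps sigma_S)
  then have "sigma_op r * Y_op = Y_op * sigma_op r"
    unfolding Y_op_def by (metis sigma_X mult.assoc)
  then show ?thesis by (simp add: L_op_def algebra_simps sigma_S)
qed

lemma sigma_u: "i < r \<Longrightarrow> sigma_op r * u_op i = q_op * u_op i * sigma_op r"
  unfolding sigma_mono mono_op_mult
  by (rule arg_cong[where f = "\<lambda>w. mono_op w * _"]) (auto simp: unit_weight_def deg_def)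

abbreviation qu_op :: "nat \<Rightarrow> oper" where "qu_op i \<equiv> q_op * u_op i"

lemma sigma_prod:
  assumes "n \<le> r"
  shows "sigma_op r * prod_op u_op L_op n = prod_op qu_op L_op n * sigma_op r"
  using assms
proof (induction n)
  case (Suc n)
  have "sigma_op r * (1 + u_op n * L_op) = (1 + qu_op n * L_op) * sigma_op r"
    using sigma_u[of n r] Suc.prems sigma_L[of r] by (simp add: algebra_simps) (metis mult.assoc)
  then show ?case using Suc by (simp flip: mult.assoc) (simp add: mult.assoc)
qed simp

lemma sigma_quot:
  assumes "n \<le> r"
  shows "sigma_op r * quot_op u_op L_op n = quot_op qu_op L_op n * sigma_op r"
  using assms
proof (induction n)
  case (Suc n)
  have "sigma_op r * (u_op n * prod_op u_op L_op n) = qu_op n * prod_op qu_op L_op n * sigma_op r"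
    using sigma_u[of n r] Suc.prems sigma_prod[of n r] by (metis mult.assoc Suc_leD Suc_le_lessD)
  then show ?case using Suc by (simp add: algebra_simps)
qed simp

section \<open>Vanishing conditions and uniqueness\<close>

text \<open>\<open>R\<close> selects coefficients. It is used for those with
  \<open>x Size < m\<close>, those of low degree in the \<open>u\<close> variables, and those at
  \<open>m = 0\<close>.\<close>

definition vanishes :: "(nat \<Rightarrow> weight \<Rightarrow> bool) \<Rightarrow> series \<Rightarrow> bool" where
  "vanishes R f \<longleftrightarrow> (\<forall>m x. R m x \<longrightarrow> f m x = 0)"

definition preserves :: "(nat \<Rightarrow> weight \<Rightarrow> bool) \<Rightarrow> oper \<Rightarrow> bool" where
  "preserves R T \<longleftrightarrow> (\<forall>f. vanishes R f \<longrightarrow> vanishes R (app T f))"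

lemma vanishes_add: "vanishes R f \<Longrightarrow> vanishes R g \<Longrightarrow> vanishes R (f + g)"
  by (simp add: vanishes_def)

lemma preserves_1: "preserves R 1"
  by (simp add: preserves_def)

lemma preserves_mult: "preserves R T \<Longrightarrow> preserves R U \<Longrightarrow> preserves R (T * U)"
  by (simp add: preserves_def)

lemma preserves_add: "preserves R T \<Longrightarrow> preserves R U \<Longrightarrow> preserves R (T + U)"
  by (simp add: preserves_def vanishes_def)

lemma preserves_diff: "preserves R T \<Longrightarrow> preserves R U \<Longrightarrow> preserves R (T - U)"
  by (simp add: preserves_def vanishes_def)

lemma preserves_uminus: "preserves R T \<Longrightarrow> preserves R (- T)"
  by (simp add: preserves_def vanishes_def)

lemma preserves_prod_op:
  "\<lbrakk>\<And>i. preserves R (u i); preserves R L\<rbrakk> \<Longrightarrow> preserves R (prod_op u L n)"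
  by (induction n) (simp_all add: preserves_1 preserves_mult preserves_add)

text \<open>\<open>L\<close> and \<open>K\<close> are assumed to agree only on \<open>a\<close>, and
  only on the coefficients in \<open>R\<close>. Commutation brings the difference
  \<open>L - K\<close> next to \<open>a\<close>, and the remaining operators preserve the
  vanishing.\<close>

lemma prod_op_congruent:
  assumes pu: "\<And>i. preserves R (u i)" and pL: "preserves R L" and pK: "preserves R K"
    and uu: "\<And>i j. u i * u j = u j * u i"
    and uL: "\<And>i. u i * L = L * u i" and uK: "\<And>i. u i * K = K * u i" and LK: "L * K = K * L"
    and LKa: "vanishes R (app L a - app K a)"
  shows "vanishes R (app (prod_op u L n) a - app (prod_op u K n) a)"
proof (induction n)
  case 0
  then show ?case by (simp add: vanishes_def)
next
  case (Suc n)
  let ?P = "prod_op u L n" and ?C = "prod_op u K n"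
  have C: "preserves R ?C" using pu pK by (rule preserves_prod_op)
  have CL: "?C * L = L * ?C" by (rule prod_op_commute) (use uL LK in simp_all)
  have PL: "?P * (u n * L) = u n * (L * ?P)"
    by (metis prod_op_commute[of u "u n" L n, OF uu uL[symmetric]] prod_op_commute[of u L L n, OF uL refl] mult.assoc)
  have CK: "?C * (u n * K) = u n * (K * ?C)"
    by (metis prod_op_commute[of u "u n" K n, OF uu uK[symmetric]] prod_op_commute[of u K K n, OF uK refl] mult.assoc)
  have E1: "app (prod_op u L (Suc n)) a = app ?P a + app (u n) (app L (app ?P a))"
    using arg_cong[OF PL, of "\<lambda>T. app T a"] by (simp add: distrib_left del: plus_fun_apply)
  have E2: "app (prod_op u K (Suc n)) a = app ?C a + app (u n) (app K (app ?C a))"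
    using arg_cong[OF CK, of "\<lambda>T. app T a"] by (simp add: distrib_left del: plus_fun_apply)
  have "app ?C (app L a - app K a) = app L (app ?C a) - app K (app ?C a)"
    using arg_cong[OF CL, of "\<lambda>T. app T a"] arg_cong[OF prod_op_commute[of u K K n, OF uK refl], of "\<lambda>T. app T a"]
    by (simp add: app_diff)
  then have "vanishes R (app L (app ?C a) - app K (app ?C a))"
    using C LKa unfolding preserves_def by metis
  moreover have "vanishes R (app L (app ?P a - app ?C a))"
    using Suc pL unfolding preserves_def by metis
  ultimately have "vanishes R (app L (app ?P a) - app K (app ?C a))"
    using vanishes_add unfolding app_diff by fastforce
  then have "vanishes R (app (u n) (app L (app ?P a) - app K (app ?C a)))"
    using pu unfolding preserves_def by metis
  then have "vanishes R ((app ?P a - app ?C a) + app (u n) (app L (app ?P a) - app K (app ?C a)))"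
    using Suc vanishes_add by metis
  moreover have "(app ?P a - app ?C a) + app (u n) (app L (app ?P a) - app K (app ?C a))
     = app (prod_op u L (Suc n)) a - app (prod_op u K (Suc n)) a"
    unfolding E1 E2 app_diff by (simp add: algebra_simps)
  ultimately show ?case by metis
qed

lemma preserves_mono_op:
  "(\<And>m x. R m x \<Longrightarrow> \<forall>s. w s \<le> x s \<Longrightarrow> R m (\<lambda>s. x s - w s)) \<Longrightarrow> preserves R (mono_op w)"
  unfolding preserves_def vanishes_def by (transfer fixing: R w) (simp add: shift_def)

lemma preserves_S_op: "(\<And>m x. R m x \<Longrightarrow> R (Suc m) x) \<Longrightarrow> preserves R S_op"
  unfolding preserves_def vanishes_def by (transfer fixing: R) simp

lemma preserves_X_op:
  "(\<And>m x. R m x \<Longrightarrow> m \<le> x Size \<Longrightarrow> R m (\<lambda>s. x s - (if s = Size then m else 0))) \<Longrightarrow> preserves R X_op"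
  unfolding preserves_def vanishes_def
  by (transfer fixing: R) (auto simp: shift_def dest: spec[of _ Size])

text \<open>The coefficients that no nonempty sequence of parts at least \<open>m\<close> can reach,
  so that the series is known there explicitly.\<close>

definition large :: "nat \<Rightarrow> weight \<Rightarrow> bool" where
  "large m x \<longleftrightarrow> x Size < m"

text \<open>\<open>M\<close> is \<open>UNIV\<close> in arguments where \<open>m\<close> varies, and
  \<open>{0}\<close> when only the series at \<open>m = 0\<close> matters.\<close>

definition small_deg :: "nat \<Rightarrow> nat set \<Rightarrow> nat \<Rightarrow> nat \<Rightarrow> weight \<Rightarrow> bool" where
  "small_deg r M N m x \<longleftrightarrow> m \<in> M \<and> deg r x < N"

lemma deg_diff_le: "deg r (\<lambda>s. x s - w s) \<le> deg r x"
  unfolding deg_def by (rule sum_mono) simp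

lemma preserves_large:
  "preserves large (mono_op w)" "preserves large S_op" "preserves large Y_op" "preserves large L_op"
proof -
  show w: "preserves large (mono_op w)" for w
    by (rule preserves_mono_op) (auto simp: large_def)
  show S: "preserves large S_op" by (rule preserves_S_op) (auto simp: large_def)
  have "preserves large X_op" by (rule preserves_X_op) (auto simp: large_def)
  then show Y: "preserves large Y_op"
    unfolding Y_op_def by (intro preserves_mult preserves_add w S)
  show "preserves large L_op" unfolding L_op_def by (intro preserves_diff S Y)
qed

lemma preserves_small_deg_mono_op: "preserves (small_deg r M N) (mono_op w)"
  by (rule preserves_mono_op) (auto simp: small_deg_def intro: le_less_trans[OF deg_diff_le])

lemma preserves_small_deg:
  "preserves (small_deg r UNIV N) Y_op" "preserves (small_deg r UNIV N) L_op"
proof -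
  have S: "preserves (small_deg r UNIV N) S_op" by (rule preserves_S_op) (auto simp: small_deg_def)
  have "preserves (small_deg r UNIV N) X_op"
    by (rule preserves_X_op) (auto simp: small_deg_def intro: le_less_trans[OF deg_diff_le])
  then show Y: "preserves (small_deg r UNIV N) Y_op"
    unfolding Y_op_def by (intro preserves_mult preserves_add preserves_small_deg_mono_op S)
  show "preserves (small_deg r UNIV N) L_op" unfolding L_op_def by (intro preserves_diff S Y)
qed

lemma vanishes_u_op:
  assumes "vanishes (small_deg r M N) f" "i < r"
  shows "vanishes (small_deg r M (Suc N)) (app (u_op i) f)"
  unfolding vanishes_def
proof (intro allI impI)
  fix m x
  assume mx: "small_deg r M (Suc N) m x"
  let ?w = "unit_weight (Prim i)"
  have app: "app (u_op i) f m x = shift ?w (f m) x" by transfer simp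
  show "app (u_op i) f m x = 0"
  proof (cases "\<forall>s. ?w s \<le> x s")
    case True
    have "deg r x = deg r (\<lambda>s. x s - ?w s) + deg r ?w"
      using True by (auto simp: deg_def simp flip: sum.distrib intro!: sum.cong)
    moreover have "deg r ?w = 1" using assms(2) by (simp add: deg_def unit_weight_def)
    ultimately have "small_deg r M N m (\<lambda>s. x s - ?w s)" using mx by (auto simp: small_deg_def)
    then show ?thesis using assms(1) unfolding app by (simp add: shift_def vanishes_def)
  qed (simp only: app shift_def if_False)
qed

text \<open>Every term of \<open>quot_op\<close> has at least one factor \<open>u i\<close>, which
  raises the lowest degree by one. \<open>u\<close> is kept general to cover both
  \<open>u_op\<close> and \<open>qu_op\<close>.\<close>

lemma vanishes_quot_op:
  assumes "vanishes (small_deg r M N) f" "n \<le> r" "preserves (small_deg r M N) L"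
    and "\<And>i. preserves (small_deg r M N) (u i)"
    and "\<And>f i. i < r \<Longrightarrow> vanishes (small_deg r M N) f \<Longrightarrow> vanishes (small_deg r M (Suc N)) (app (u i) f)"
  shows "vanishes (small_deg r M (Suc N)) (app (quot_op u L n) f)"
  using assms(2)
proof (induction n)
  case 0
  then show ?case by (simp add: vanishes_def)
next
  case (Suc n)
  have "preserves (small_deg r M N) (prod_op u L n)"
    using assms(3,4) by (intro preserves_prod_op)
  then have "vanishes (small_deg r M N) (app (prod_op u L n) f)"
    using assms(1) by (simp add: preserves_def)
  then have "vanishes (small_deg r M (Suc N)) (app (u n) (app (prod_op u L n) f))"
    using Suc.prems assms(5) by simp
  from vanishes_add[OF Suc.IH[OF Suc_leD[OF Suc.prems]] this] show ?case
    unfolding quot_op.simps app_simps .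
qed

section \<open>Solutions of the operator equation and their functional equation\<close>

lemma app_mono_op: "app (mono_op w) f m = shift w (f m)"
  by transfer simp

lemma app_S_op: "app S_op f m = f (Suc m)"
  by transfer simp

lemma app_X_op: "app X_op f m = shift (\<lambda>s. if s = Size then m else 0) (f m)"
  by transfer simp

lemma app_sigma_op:
  "app (sigma_op r) f m x = (if deg r x \<le> x Size then f m (x(Size := x Size - deg r x)) else 0)"
  by transfer simp

text \<open>\<open>X_op\<close> multiplies by \<open>q ^ m\<close>, which leaves no coefficient with
  \<open>x Size < m\<close>.\<close>

lemma vanishes_large_Y: "vanishes large (app Y_op f)"
  by (auto simp: vanishes_def large_def Y_op_def app_X_op shift_def)

text \<open>Induction on the degree in the \<open>u\<close> variables. The right-hand side has
  higher degree than \<open>b\<close>, so at the lowest degree \<open>b\<close> does not depend on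
  \<open>m\<close>; raising \<open>m\<close> past \<open>x Size\<close> then gives 0.\<close>

lemma vanishing_solution:
  assumes eq: "b - app S_op b = app (Y_op * quot_op qu_op L_op r) b" and large: "vanishes large b"
  shows "b = 0"
proof -
  have van: "vanishes (small_deg r UNIV N) b" for N
  proof (induction N)
    case 0
    then show ?case by (simp add: vanishes_def small_deg_def)
  next
    case (Suc N)
    have "vanishes (small_deg r UNIV (Suc N)) (app (quot_op qu_op L_op r) b)"
    proof (rule vanishes_quot_op[OF Suc order_refl])
      show "preserves (small_deg r UNIV N) (qu_op i)" for i
        by (intro preserves_mult preserves_small_deg_mono_op)
      show "vanishes (small_deg r UNIV (Suc N)) (app (qu_op i) f)"
        if "i < r" "vanishes (small_deg r UNIV N) f" for f i
        using vanishes_u_op[OF that(2,1)] preserves_small_deg_mono_op by (auto simp: preserves_def)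
    qed (rule preserves_small_deg)
    then have *: "vanishes (small_deg r UNIV (Suc N)) (b - app S_op b)"
      unfolding eq using preserves_small_deg(1) by (auto simp: preserves_def)
    show ?case unfolding vanishes_def
    proof (intro allI impI)
      fix m x
      assume x: "small_deg r UNIV (Suc N) m x"
      then have step: "b j x = b (Suc j) x" for j
        using *[unfolded vanishes_def, rule_format, of j x] x by (simp add: small_deg_def app_S_op)
      have "b m x = b (m + j) x" for j
        by (induction j) (simp, metis step add_Suc_right)
      then have "b m x = b (m + Suc (x Size)) x" by blast
      also have "\<dots> = 0" using large by (auto simp: vanishes_def large_def)
      finally show "b m x = 0" .
    qed
  qed
  show ?thesis
  proof (intro ext)
    fix m x
    show "b m x = 0 m x" using van[of "Suc (deg r x)"] by (simp add: vanishes_def small_deg_def)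
  qed
qed

text \<open>\<open>vanishing_solution\<close> is applied to the difference of the two sides, both of
  which solve the equation with \<open>q u\<close> for \<open>u\<close>. For
  \<open>x Size < m\<close> they agree: \<open>Y_op\<close> contributes nothing there and
  \<open>a\<close> is the constant 1, so \<open>L_op\<close> acts on \<open>a\<close> as
  \<open>1\<close>, and \<open>?s\<close> fixes \<open>a\<close>.\<close>

lemma functional_equation:
  assumes eq: "a - app S_op a = app (Y_op * quot_op u_op L_op r) a"
    and large: "\<And>m x. x Size < m \<Longrightarrow> a m x = (if \<forall>s. x s = 0 then 1 else 0)"
  shows "app (prod_op u_op L_op r) a = app (prod_op u_op 1 r * sigma_op r) a"
proof -
  let ?P = "prod_op u_op L_op r" and ?Q = "quot_op u_op L_op r"
  let ?P' = "prod_op qu_op L_op r" and ?Q' = "quot_op qu_op L_op r"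
  let ?C = "prod_op u_op 1 r" and ?s = "sigma_op r"
  have quL: "qu_op i * L_op = L_op * qu_op i" for i
    by (metis mono_op_mult mono_op_L)
  have ququ: "qu_op i * qu_op j = qu_op j * qu_op i" for i j
    by (metis mono_op_mult mono_op_commute)
  have P: "?P = 1 + L_op * ?Q"
    using prod_op_eq_quot_op[of u_op L_op r, OF mono_op_L u_op_commute]
      quot_op_commute[of u_op L_op L_op r, OF mono_op_L refl] by simp
  have P': "?P' = 1 + L_op * ?Q'"
    using prod_op_eq_quot_op[of qu_op L_op r, OF quL ququ]
      quot_op_commute[of qu_op L_op L_op r, OF quL refl] by simp
  have PQ: "?P * ?Q = ?Q * ?P"
    by (rule prod_op_commute)
      (simp_all only: quot_op_commute[OF mono_op_commute mono_op_L[symmetric], symmetric]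
        quot_op_commute[OF mono_op_L refl])
  \<comment> \<open>\<open>eq\<close> replaces \<open>Y_op * ?Q\<close> by \<open>1 - S_op\<close>
    on \<open>a\<close>, so that only terms with \<open>S_op\<close> remain.\<close>
  have Pa: "app ?P a = app (S_op * (1 + ?Q)) a"
    using eq unfolding P by (simp add: L_op_def algebra_simps app_add)
  have twist: "?P' * S_op = S_op * ?P - S_op * (?Q - ?Q') * S_op"
    using prod_op_twist[of u_op L_op S_op q_op r, OF mono_op_L u_op_commute mono_op_S mono_op_commute
        mono_op_L mono_op_S S_L] by (simp add: algebra_simps)
  have sol1: "app ?P' (app ?P a) = app (S_op * (1 + ?Q')) (app ?P a)"
  proof -
    have "app ?P' (app ?P a) = app (?P' * S_op * (1 + ?Q)) a"
      unfolding Pa by (simp add: algebra_simps app_add)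
    \<comment> \<open>\<open>twist\<close> moves \<open>?P'\<close> past \<open>S_op\<close>. In its
      error term, \<open>S_op * (1 + ?Q)\<close> is again \<open>?P\<close> on \<open>a\<close>, and
      this turns \<open>?Q\<close> into \<open>?Q'\<close>.\<close>
    also have "?P' * S_op * (1 + ?Q) = S_op * (1 + ?Q) * ?P - S_op * (?Q - ?Q') * (S_op * (1 + ?Q))"
      unfolding twist by (simp add: algebra_simps PQ)
    also have "app \<dots> a = app (S_op * (1 + ?Q) * ?P) a - app (S_op * (?Q - ?Q')) (app ?P a)"
      unfolding Pa by simp
    also have "\<dots> = app (S_op * (1 + ?Q')) (app ?P a)"
      by (simp add: algebra_simps app_add app_diff)
    finally show ?thesis .
  qed
  have CS: "?C * S_op = S_op * ?C" by (rule prod_op_commute) (simp_all add: mono_op_S)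
  have CL: "L_op * ?C = ?C * L_op" by (rule prod_op_commute[symmetric]) (simp_all add: mono_op_L)
  have Cqu: "qu_op i * ?C = ?C * qu_op i" for i
    by (rule prod_op_commute[symmetric]) (simp_all only: mono_op_mult add.assoc add.commute add.left_commute mult_1 mult_1_right)
  have CP': "?C * ?P' = ?P' * ?C" by (rule prod_op_commute[symmetric]) (fact Cqu CL)+
  have CQ': "?C * ?Q' = ?Q' * ?C" by (rule quot_op_commute[symmetric]) (fact Cqu CL)+
  then have C1Q': "?C * (1 + ?Q') = (1 + ?Q') * ?C" by (simp add: distrib_left distrib_right)
  \<comment> \<open>The second solution is \<open>Pa\<close> transformed: \<open>?s\<close> changes
    \<open>?P\<close> and \<open>?Q\<close> into \<open>?P'\<close> and \<open>?Q'\<close>, and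
    \<open>?C\<close> commutes with \<open>S_op\<close>, \<open>?P'\<close> and
    \<open>?Q'\<close>.\<close>
  have "app ?P' (app (?C * ?s) a) = app (?C * (?P' * ?s)) a"
    using CP' by (metis app_simps(6))
  also have "\<dots> = app ?C (app ?s (app ?P a))"
    using sigma_prod[of r r] by (metis app_simps(6) order_refl)
  also have "\<dots> = app (?C * (?s * (S_op * (1 + ?Q)))) a" unfolding Pa by simp
  also have "?s * (S_op * (1 + ?Q)) = S_op * (1 + ?Q') * ?s"
    using sigma_S[of r] sigma_quot[of r r] by (simp add: distrib_left distrib_right) (metis mult.assoc)
  also have "?C * (S_op * (1 + ?Q') * ?s) = S_op * (1 + ?Q') * (?C * ?s)"
  proof -
    have "?C * (S_op * (1 + ?Q') * ?s) = ?C * S_op * (1 + ?Q') * ?s" by (simp only: mult.assoc)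
    also have "\<dots> = S_op * (?C * (1 + ?Q')) * ?s" by (simp only: CS mult.assoc)
    also have "\<dots> = S_op * (1 + ?Q') * (?C * ?s)" by (simp only: C1Q' mult.assoc)
    finally show ?thesis .
  qed
  finally have sol2: "app ?P' (app (?C * ?s) a) = app (S_op * (1 + ?Q')) (app (?C * ?s) a)" by simp
  txt \<open>Two solutions of the twisted equation that agree for large \<open>m\<close>.\<close>
  define b where "b = app ?P a - app (?C * ?s) a"
  have "app ?P' b = app (S_op * (1 + ?Q')) b"
    unfolding b_def app_diff sol1 sol2 ..
  then have "b - app S_op b = app (Y_op * ?Q') b"
    unfolding P' by (simp add: L_op_def algebra_simps app_add)
  moreover have "vanishes large b"
  proof -
    have "vanishes large (a - app S_op a)" unfolding eq app_simps by (rule vanishes_large_Y)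
    then have "vanishes large ((app L_op a - app 1 a))"
      using vanishes_large_Y[of a] by (simp add: L_op_def vanishes_def)
    then have 1: "vanishes large (app ?P a - app ?C a)"
      by (intro prod_op_congruent preserves_large preserves_1 u_op_commute mono_op_L) simp_all
    have "vanishes large (a - app ?s a)"
      unfolding vanishes_def
    proof (intro allI impI)
      fix m x
      assume "large m x"
      then have m: "x Size < m" by (simp add: large_def)
      let ?x = "x(Size := x Size - deg r x)"
      \<comment> \<open>Either all exponents except \<open>Size\<close> are 0, so that
        \<open>deg r x = 0\<close> and nothing is shifted, or both sides are false.\<close>
      have 1: "deg r x \<le> x Size \<and> (\<forall>s. (x(Size := x Size - deg r x)) s = 0) \<longleftrightarrow> (\<forall>s. x s = 0)"
      proof (cases "\<forall>s. s \<noteq> Size \<longrightarrow> x s = 0")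
        case True
        then have "deg r x = 0" by (simp add: deg_def)
        then show ?thesis by simp
      next
        case False
        then obtain s where "s \<noteq> Size" "x s \<noteq> 0" by blast
        then have "\<not> (\<forall>s. (x(Size := x Size - deg r x)) s = 0)" "\<not> (\<forall>s. x s = 0)"
          by (auto intro!: exI[of _ s])
        then show ?thesis by (simp only: simp_thms)
      qed
      have "a m ?x = (if \<forall>s. ?x s = 0 then 1 else 0)" by (rule large) (use m in simp)
      then have "app ?s a m x = (if deg r x \<le> x Size \<and> (\<forall>s. ?x s = 0) then 1 else 0)"
        by (cases "deg r x \<le> x Size") (simp_all only: app_sigma_op if_True if_False simp_thms)
      then show "(a - app ?s a) m x = 0"
        unfolding 1 using m large[of x m] by simp
    qed
    then have "vanishes large (app ?C (a - app ?s a))"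
      using preserves_prod_op[of large u_op 1 r, OF preserves_large(1) preserves_1, unfolded preserves_def]
      by blast
    from vanishes_add[OF 1 this] show ?thesis by (simp add: b_def app_diff)
  qed
  ultimately have "b = 0" by (rule vanishing_solution)
  then show ?thesis by (simp add: b_def)
qed

text \<open>At \<open>m = 0\<close> the operator \<open>X_op\<close> is the identity, so the two
  \<open>S_op\<close> terms of \<open>L_op\<close> cancel and \<open>- d_op\<close> remains.\<close>

lemma functional_equation_at_0:
  assumes "app (prod_op u_op L_op r) a = app (prod_op u_op 1 r * sigma_op r) a"
  shows "app (prod_op u_op (- d_op) r) a 0 = app (prod_op u_op 1 r * sigma_op r) a 0"
proof -
  let ?R = "\<lambda>m x. m = 0"
  have L0: "app L_op f 0 = - app d_op f 0" for f
    by (simp add: L_op_def Y_op_def app_X_op app_S_op shift_0 fun_eq_iff if_distrib cong: if_cong)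
  have w: "preserves ?R (mono_op w)" for w by (rule preserves_mono_op) simp
  have "preserves ?R L_op"
    using w[of "unit_weight Plain"] by (simp add: preserves_def vanishes_def L0)
  moreover have "vanishes ?R (app L_op a - app (- d_op) a)"
    by (simp add: vanishes_def L0)
  ultimately have "vanishes ?R (app (prod_op u_op L_op r) a - app (prod_op u_op (- d_op) r) a)"
    by (intro prod_op_congruent w preserves_uminus u_op_commute mono_op_L)
       (simp_all add: mono_op_L mono_op_commute)
  then show ?thesis unfolding assms by (auto simp: vanishes_def)
qed

text \<open>At the lowest degree where the difference \<open>f\<close> may be nonzero, both products
  act as the identity. So the coefficient of \<open>f\<close> at \<open>x\<close> equals one with
  \<open>Size\<close> smaller by \<open>deg r x\<close>, or is 0. This gives an induction on the
  degree and, inside it, on \<open>Size\<close>, with \<open>base\<close> covering degree 0.\<close>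

lemma functional_equation_unique:
  assumes a: "app (prod_op u_op (- d_op) r) a 0 = app (prod_op u_op 1 r * sigma_op r) a 0"
    and b: "app (prod_op u_op (- d_op) r) b 0 = app (prod_op u_op 1 r * sigma_op r) b 0"
    and base: "\<And>x. deg r x = 0 \<Longrightarrow> a 0 x = b 0 x"
  shows "a 0 = b 0"
proof -
  define f where "f = a - b"
  let ?D = "prod_op u_op (- d_op) r" and ?C = "prod_op u_op 1 r" and ?s = "sigma_op r"
  have f: "app ?D f 0 = app ?C (app ?s f) 0"
    using a b by (simp add: f_def app_diff)
  have level: "app (prod_op u_op K r) g 0 x = g 0 x"
    if "vanishes (small_deg r {0} (deg r x)) g" "\<And>N. preserves (small_deg r {0} N) K"
      "\<And>i. u_op i * K = K * u_op i" for K g x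
  proof -
    have "vanishes (small_deg r {0} (Suc (deg r x))) (app (quot_op u_op K r) (app K g))"
    proof (rule vanishes_quot_op)
      show "vanishes (small_deg r {0} (deg r x)) (app K g)"
        using that(1,2) by (simp add: preserves_def)
    qed (auto intro: that(2) preserves_small_deg_mono_op vanishes_u_op)
    moreover have "prod_op u_op K r = 1 + quot_op u_op K r * K"
      by (rule prod_op_eq_quot_op[OF that(3) u_op_commute])
    ultimately show ?thesis by (simp add: vanishes_def small_deg_def)
  qed
  have "f 0 x = 0" for x
  proof (induction "deg r x" arbitrary: x rule: less_induct)
    case less
    note deg_IH = less
    show ?case using deg_IH
    proof (induction "x Size" arbitrary: x rule: less_induct)
      case less
      show ?case
      proof (cases "deg r x = 0")
        case True
        then show ?thesis using base by (simp add: f_def)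
      next
        case False
        let ?x = "x(Size := x Size - deg r x)"
        have dx: "deg r (y(Size := k)) = deg r y" for y k by (simp add: deg_def)
        have 1: "vanishes (small_deg r {0} (deg r x)) f"
          using less.prems by (simp add: vanishes_def small_deg_def)
        then have 2: "vanishes (small_deg r {0} (deg r x)) (app ?s f)"
          by (auto simp: vanishes_def small_deg_def app_sigma_op dx)
        have "f 0 x = app ?D f 0 x"
          by (rule level[OF 1, symmetric]) (auto intro: preserves_uminus preserves_small_deg_mono_op simp: mono_op_commute)
        also have "\<dots> = app ?s f 0 x"
          unfolding f by (rule level[OF 2]) (auto intro: preserves_1)
        also have "\<dots> = 0"
        proof (cases "deg r x \<le> x Size")
          case True
          then have "f 0 ?x = 0"
            using False less.prems less.hyps[of ?x] by (simp add: dx)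
          then show ?thesis by (simp add: app_sigma_op)
        qed (simp add: app_sigma_op)
        finally show ?thesis .
      qed
    qed
  qed
  then show ?thesis by (auto simp: f_def fun_eq_iff)
qed

section \<open>Generating functions of weighted sets\<close>

definition gf :: "('o \<Rightarrow> weight) \<Rightarrow> 'o set \<Rightarrow> weight \<Rightarrow> int" where
  "gf wt A x = int (card {s \<in> A. wt s = x})"

text \<open>\<open>card\<close> is 0 on infinite sets, so additivity of \<open>gf\<close> relies on
  each weight being attained finitely often.\<close>

definition finite_fibres :: "('o \<Rightarrow> weight) \<Rightarrow> 'o set \<Rightarrow> bool" where
  "finite_fibres wt A \<longleftrightarrow> (\<forall>x. finite {s \<in> A. wt s = x})"

lemma finite_fibres_subset:
  assumes "finite_fibres wt B" "A \<subseteq> B"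
  shows "finite_fibres wt A"
  unfolding finite_fibres_def
proof
  show "finite {s \<in> A. wt s = x}" for x
    by (rule finite_subset[of _ "{s \<in> B. wt s = x}"]) (use assms in \<open>auto simp: finite_fibres_def\<close>)
qed

lemma gf_Un:
  assumes "finite_fibres wt (A \<union> B)" "A \<inter> B = {}"
  shows "gf wt (A \<union> B) = gf wt A + gf wt B"
proof
  fix x
  have "{s \<in> A \<union> B. wt s = x} = {s \<in> A. wt s = x} \<union> {s \<in> B. wt s = x}" by auto
  moreover have "finite {s \<in> A. wt s = x}" "finite {s \<in> B. wt s = x}"
    using assms(1) finite_fibres_subset[OF assms(1), of A] finite_fibres_subset[OF assms(1), of B]
    by (auto simp: finite_fibres_def)
  moreover have "{s \<in> A. wt s = x} \<inter> {s \<in> B. wt s = x} = {}" using assms(2) by auto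
  ultimately show "gf wt (A \<union> B) x = (gf wt A + gf wt B) x"
    by (simp add: gf_def card_Un_disjoint)
qed

lemma gf_UN:
  assumes "finite I" "finite_fibres wt (\<Union>i\<in>I. A i)"
    and "\<And>i j. i \<in> I \<Longrightarrow> j \<in> I \<Longrightarrow> i \<noteq> j \<Longrightarrow> A i \<inter> A j = {}"
  shows "gf wt (\<Union>i\<in>I. A i) = (\<Sum>i\<in>I. gf wt (A i))"
  using assms
proof (induction I rule: finite_induct)
  case empty
  show ?case by (auto simp: gf_def)
next
  case (insert i I)
  have "gf wt (\<Union>i\<in>insert i I. A i) = gf wt (A i \<union> (\<Union>i\<in>I. A i))" by simp
  also have "\<dots> = gf wt (A i) + gf wt (\<Union>i\<in>I. A i)"
  proof (rule gf_Un)
    show "finite_fibres wt (A i \<union> (\<Union>i\<in>I. A i))" using insert.prems(1) by simp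
    show "A i \<inter> (\<Union>i\<in>I. A i) = {}" using insert.prems(2)[of i] insert.hyps(2) by fastforce
  qed
  also have "gf wt (\<Union>i\<in>I. A i) = (\<Sum>i\<in>I. gf wt (A i))"
    using insert.prems by (intro insert.IH finite_fibres_subset[OF insert.prems(1)]) auto
  finally show ?case by (simp only: sum.insert[OF insert.hyps])
qed

lemma gf_image:
  assumes "inj_on h A" "\<And>s. s \<in> A \<Longrightarrow> wt (h s) = w + wt s"
  shows "gf wt (h ` A) = shift w (gf wt A)"
proof
  fix x
  show "gf wt (h ` A) x = shift w (gf wt A) x"
  proof (cases "\<forall>s. w s \<le> x s")
    case True
    have *: "w + y = x \<longleftrightarrow> y = (\<lambda>s. x s - w s)" for y
    proof
      assume "w + y = x"
      then have "w s + y s = x s" for s by (metis plus_fun_apply)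
      then show "y = (\<lambda>s. x s - w s)" by (metis diff_add_inverse)
    next
      assume "y = (\<lambda>s. x s - w s)"
      then show "w + y = x" using True by (simp add: fun_eq_iff)
    qed
    have "{s \<in> h ` A. wt s = x} = h ` {s \<in> A. wt s = (\<lambda>s. x s - w s)}"
      using assms(2) * by force
    moreover have "inj_on h {s \<in> A. wt s = (\<lambda>s. x s - w s)}"
      using assms(1) by (rule inj_on_subset) auto
    ultimately show ?thesis using True by (simp add: gf_def shift_def card_image)
  next
    case False
    then have "w + y \<noteq> x" for y by (metis le_add1 plus_fun_apply)
    then have "wt (h s) \<noteq> x" if "s \<in> A" for s unfolding assms(2)[OF that] .
    then have "{s \<in> h ` A. wt s = x} = {}" by blast
    then show ?thesis unfolding gf_def shift_def using False by (simp only: if_False card.empty of_nat_0)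
  qed
qed

text \<open>The parameter \<open>has\<close> lets one weight serve both sides: it is
  \<open>eps\<close> for sequences and equality for overpartitions. \<open>Suc\<close> converts
  variable indices from 0 into colours from 1.\<close>

definition part_weight :: "(nat \<Rightarrow> nat \<Rightarrow> bool) \<Rightarrow> cpart \<Rightarrow> weight" where
  "part_weight has p s = (case s of Prim j \<Rightarrow> of_bool (has (Suc j) (part_col p))
     | Plain \<Rightarrow> of_bool (\<not> part_ovl p) | Size \<Rightarrow> part_val p)"

section \<open>Binary colours\<close>

lemma eps_small:
  assumes "c < 2 ^ i" "i \<le> j"
  shows "\<not> eps (Suc j) c"
proof -
  have "c < 2 ^ j" using assms(1) by (rule less_le_trans) (use assms(2) in simp)
  then show ?thesis by (simp add: eps_def)
qed

lemma eps_add_power: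
  assumes "c < 2 ^ i"
  shows "eps (Suc j) (2 ^ i + c) \<longleftrightarrow> j = i \<or> eps (Suc j) c"
proof (cases j i rule: linorder_cases)
  case less
  then obtain k where k: "i = Suc k + j" by (metis add_Suc less_iff_Suc_add add.commute)
  have "(2 ^ i + c) div 2 ^ j = 2 ^ Suc k + c div (2::nat) ^ j"
    unfolding k power_add by (subst div_mult_self3) auto
  then show ?thesis using less by (simp add: eps_def)
next
  case equal
  then show ?thesis using assms by (simp add: eps_def div_add_self1)
next
  case greater
  then have "c < 2 ^ j" "2 ^ i + c < 2 ^ j"
    using assms power_increasing[of "Suc i" j "2::nat"] by auto
  then show ?thesis using greater eps_small by blast
qed

text \<open>Colours are peeled from the leading digit: \<open>Suc i\<close> is the largest primary
  colour, and \<open>c'\<close> collects the smaller ones, with \<open>c' = 0\<close> if there are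
  none.\<close>

lemma binary_leading:
  fixes c :: nat
  assumes "0 < c" "c < 2 ^ r"
  obtains i c' where "i < r" "c' < 2 ^ i" "c = 2 ^ i + c'"
proof -
  have "\<exists>i<r. \<exists>c'<2^i. c = 2 ^ i + c'"
    using assms
  proof (induction r)
    case (Suc r)
    show ?case
    proof (cases "c < 2 ^ r")
      case True
      then show ?thesis using Suc by (meson less_SucI)
    next
      case False
      then have "c = 2 ^ r + (c - 2 ^ r)" "c - 2 ^ r < 2 ^ r" using Suc.prems by auto
      then show ?thesis by blast
    qed
  qed simp
  then show ?thesis using that by blast
qed

lemma prim_cols_subset:
  assumes "c < 2 ^ i"
  shows "prim_cols r c \<subseteq> {1..i}"
proof
  fix j assume j: "j \<in> prim_cols r c"
  then obtain j' where "j = Suc j'" by (cases j) (auto simp: prim_cols_def)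
  then show "j \<in> {1..i}" using j eps_small[OF assms, of j'] by (force simp: prim_cols_def)
qed

lemma finite_prim_cols: "finite (prim_cols r c)"
  by (simp add: prim_cols_def)

lemma prim_cols_add_power:
  assumes "c < 2 ^ i" "i < r"
  shows "prim_cols r (2 ^ i + c) = insert (Suc i) (prim_cols r c)"
proof -
  have "eps j (2 ^ i + c) \<longleftrightarrow> j = Suc i \<or> eps j c" if "j \<ge> 1" for j
    using eps_add_power[OF assms(1), of "j - 1"] that by auto
  then show ?thesis using assms(2) by (auto simp: prim_cols_def)
qed

lemma prim_cols_0: "prim_cols r 0 = {}"
  by (simp add: prim_cols_def eps_def)

lemma prim_cols_nonempty: "0 < c \<Longrightarrow> c < 2 ^ r \<Longrightarrow> prim_cols r c \<noteq> {}"
  by (rule binary_leading[of c r]) (auto simp: prim_cols_add_power)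

lemma wcol_add_power: "c < 2 ^ i \<Longrightarrow> i < r \<Longrightarrow> wcol r (2 ^ i + c) = Suc (wcol r c)"
  using prim_cols_subset[of c i r]
  by (auto simp: wcol_def prim_cols_add_power card_insert_if finite_prim_cols)

lemma zcol_add_power: "c < 2 ^ i \<Longrightarrow> i < r \<Longrightarrow> zcol r (2 ^ i + c) = Suc i"
  unfolding zcol_def prim_cols_add_power
  using prim_cols_subset[of c i r] by (intro Max_eqI) (auto simp: finite_prim_cols)

lemma vcol_power: "i < r \<Longrightarrow> vcol r (2 ^ i) = Suc i"
  using prim_cols_add_power[of 0 i r] by (simp add: vcol_def prim_cols_0)

lemma vcol_add_power:
  assumes "c < 2 ^ i" "i < r" "0 < c"
  shows "vcol r (2 ^ i + c) = vcol r c"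
proof -
  have "c < 2 ^ r" using assms(1) by (rule less_trans) (use assms(2) in simp)
  then have ne: "prim_cols r c \<noteq> {}" using assms(3) prim_cols_nonempty by blast
  then have "Min (prim_cols r c) \<in> prim_cols r c" by (simp add: finite_prim_cols)
  then have "Min (prim_cols r c) \<le> i" using prim_cols_subset[OF assms(1), of r] by auto
  then show ?thesis
    using ne assms by (simp add: vcol_def prim_cols_add_power finite_prim_cols)
qed

lemma col_bounds:
  assumes "0 < c" "c < 2 ^ r"
  shows "1 \<le> wcol r c" "1 \<le> vcol r c" "1 \<le> zcol r c" "zcol r c \<le> r"
proof -
  have ne: "prim_cols r c \<noteq> {}" using prim_cols_nonempty[OF assms] .
  then show "1 \<le> wcol r c" by (simp add: wcol_def finite_prim_cols Suc_le_eq card_gt_0_iff)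
  have "Min (prim_cols r c) \<in> prim_cols r c" "Max (prim_cols r c) \<in> prim_cols r c"
    using ne by (simp_all add: finite_prim_cols)
  then show "1 \<le> vcol r c" "1 \<le> zcol r c" "zcol r c \<le> r"
    by (auto simp: vcol_def zcol_def prim_cols_def)
qed

definition col_weight :: "nat \<Rightarrow> weight" where
  "col_weight c s = (case s of Prim j \<Rightarrow> of_bool (eps (Suc j) c) | _ \<Rightarrow> 0)"

lemma col_weight_0: "col_weight 0 = (\<lambda>s. 0)"
  by (auto simp: col_weight_def eps_def split: stat.split)

lemma col_weight_add_power:
  assumes "c < 2 ^ i"
  shows "col_weight (2 ^ i + c) = unit_weight (Prim i) + col_weight c"
proof
  fix s
  show "col_weight (2 ^ i + c) s = (unit_weight (Prim i) + col_weight c) s"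
    using eps_small[OF assms order_refl]
    by (cases s) (auto simp: col_weight_def unit_weight_def eps_add_power[OF assms])
qed

section \<open>Sequences with difference conditions\<close>

text \<open>Sequences are read from the last part to the first.  The parameters \<open>v\<close> and \<open>m\<close> encode the
  constraint imposed by the part read before: the next part, of colour \<open>c\<close>, has value
  at least \<open>m + 1\<close> if \<open>z(c) < v\<close>, and at least \<open>m\<close> otherwise.\<close>

fun okseq :: "nat \<Rightarrow> nat \<Rightarrow> nat \<Rightarrow> cpart list \<Rightarrow> bool" where
  "okseq r v m [] = True"
| "okseq r v m (p # ps) \<longleftrightarrow> 0 < part_col p \<and> part_col p < 2 ^ r
     \<and> m + of_bool (zcol r (part_col p) < v) \<le> part_val p
     \<and> okseq r (vcol r (part_col p)) (part_val p + (wcol r (part_col p) - 1) + of_bool (part_ovl p)) ps"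

primrec seq_weight :: "cpart list \<Rightarrow> weight" where
  "seq_weight [] = 0"
| "seq_weight (p # ps) = part_weight eps p + seq_weight ps"

text \<open>Each part has at least one primary colour, so the degree bounds the length. This makes
  the fibres finite and leaves only the empty sequence in degree 0 or for \<open>Size\<close> below
  \<open>m\<close>.\<close>

lemma okseq_parts:
  assumes "okseq r v m ys"
  shows "set ys \<subseteq> {..seq_weight ys Size} \<times> {..<2 ^ r} \<times> UNIV" "length ys \<le> deg r (seq_weight ys)"
    "ys \<noteq> [] \<Longrightarrow> m \<le> seq_weight ys Size"
proof -
  have "set ys \<subseteq> {..seq_weight ys Size} \<times> {..<2 ^ r} \<times> UNIV \<and> length ys \<le> deg r (seq_weight ys)"
    using assms
  proof (induction ys arbitrary: v m)
    case (Cons p ps)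
    then obtain v' m' where ps: "okseq r v' m' ps" by auto
    have c: "0 < part_col p" "part_col p < 2 ^ r" using Cons.prems by auto
    obtain j where "j \<in> prim_cols r (part_col p)" using prim_cols_nonempty[OF c] by auto
    then have j: "j - 1 < r" "eps (Suc (j - 1)) (part_col p)" by (auto simp: prim_cols_def)
    have "1 \<le> part_weight eps p (Prim (j - 1))" using j(2) by (simp add: part_weight_def)
    also have "\<dots> \<le> deg r (part_weight eps p)"
      unfolding deg_def using j(1) by (intro member_le_sum) auto
    finally have "Suc (length ps) \<le> deg r (seq_weight (p # ps))"
      using Cons.IH[OF ps] by (simp add: deg_add del: plus_fun_apply)
    moreover have "p \<in> {..seq_weight (p # ps) Size} \<times> {..<2 ^ r} \<times> UNIV"
      using c by (cases p) (auto simp: part_weight_def part_val_def part_col_def)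
    moreover have "set ps \<subseteq> {..seq_weight (p # ps) Size} \<times> {..<2 ^ r} \<times> UNIV"
      using Cons.IH[OF ps] by auto
    ultimately show ?case by (simp del: seq_weight.simps)
  qed simp
  then show "set ys \<subseteq> {..seq_weight ys Size} \<times> {..<2 ^ r} \<times> UNIV" "length ys \<le> deg r (seq_weight ys)"
    by auto
  show "m \<le> seq_weight ys Size" if "ys \<noteq> []"
    using assms that by (cases ys) (auto simp: part_weight_def)
qed

lemma finite_fibres_okseq: "finite_fibres seq_weight {ys. okseq r v m ys}"
  unfolding finite_fibres_def
proof
  fix x
  have "{ys \<in> {ys. okseq r v m ys}. seq_weight ys = x}
      \<subseteq> {ys. set ys \<subseteq> {..x Size} \<times> {..<2 ^ r} \<times> UNIV \<and> length ys \<le> deg r x}"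
    using okseq_parts by blast
  then show "finite {ys \<in> {ys. okseq r v m ys}. seq_weight ys = x}"
    by (rule finite_subset) (intro finite_lists_length_le finite_SigmaI; simp)
qed

text \<open>The index is shifted: \<open>seq_gf r i\<close> is the generating function for the constraint \<open>v = i + 1\<close>.\<close>

definition seq_gf :: "nat \<Rightarrow> nat \<Rightarrow> series" where
  "seq_gf r i m = gf seq_weight {ys. okseq r (Suc i) m ys}"

lemma seq_gf_vcol:
  "0 < c \<Longrightarrow> c < 2 ^ r \<Longrightarrow> gf seq_weight {ys. okseq r (vcol r c) m ys} = seq_gf r (vcol r c - 1) m"
  using col_bounds(2)[of c r] by (simp add: seq_gf_def)

text \<open>Raising \<open>v\<close> from \<open>Suc i\<close> to \<open>Suc (Suc i)\<close>
  excludes just the sequences whose first part read has value \<open>m\<close> and largest primary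
  colour \<open>Suc i\<close>. Its colour is \<open>2 ^ i + c\<close>, so the
  \<open>wcol - 1\<close> in the bound for the rest becomes \<open>wcol r c\<close>.\<close>

lemma okseq_split:
  assumes "i < r"
  shows "{ys. okseq r (Suc i) m ys} = {ys. okseq r (Suc (Suc i)) m ys} \<union>
    (\<Union>(c, ov) \<in> {..<2 ^ i} \<times> UNIV. (#) (m, 2 ^ i + c, ov) `
       {ys. okseq r (vcol r (2 ^ i + c)) (m + wcol r c + of_bool ov) ys})" (is "?A = ?B \<union> ?C")
    and "{ys. okseq r (Suc (Suc i)) m ys} \<inter>
    (\<Union>(c, ov) \<in> {..<2 ^ i} \<times> UNIV. (#) (m, 2 ^ i + c, ov) `
       {ys. okseq r (vcol r (2 ^ i + c)) (m + wcol r c + of_bool ov) ys}) = {}"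
proof -
  have lt: "2 ^ i + c < 2 ^ r" if "c < 2 ^ i" for c :: nat
    using that power_increasing[of "Suc i" r "2::nat"] assms by auto
  have C: "okseq r (Suc i) m ys" "\<not> okseq r (Suc (Suc i)) m ys" if ys: "ys \<in> ?C" for ys
  proof -
    obtain c ov zs where c: "c < 2 ^ i" "ys = (m, 2 ^ i + c, ov) # zs"
      "okseq r (vcol r (2 ^ i + c)) (m + wcol r c + of_bool ov) zs" using ys by auto
    then show "okseq r (Suc i) m ys" "\<not> okseq r (Suc (Suc i)) m ys"
      using lt[OF c(1)] assms
      by (simp_all add: part_val_def part_col_def part_ovl_def zcol_add_power wcol_add_power)
  qed
  have B: "okseq r (Suc i) m ys" if "okseq r (Suc (Suc i)) m ys" for ys
    using that by (cases ys) (auto split: if_splits)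
  have A: "ys \<in> ?C" if ys: "okseq r (Suc i) m ys" "\<not> okseq r (Suc (Suc i)) m ys" for ys
  proof (cases ys)
    case Nil
    then show ?thesis using ys by simp
  next
    case (Cons p zs)
    obtain v c ov where p: "p = (v, c, ov)" by (cases p) auto
    have c: "0 < c" "c < 2 ^ r" and z: "zcol r c = Suc i" and v: "v = m"
      using ys by (auto simp: Cons p part_val_def part_col_def of_bool_def split: if_splits)
    obtain j c' where c': "j < r" "c' < 2 ^ j" "c = 2 ^ j + c'" using binary_leading[OF c] .
    then have "j = i" using z zcol_add_power[of c' j r] by simp
    with c' have c': "c' < 2 ^ i" "c = 2 ^ i + c'" by auto
    have "okseq r (vcol r (2 ^ i + c')) (m + wcol r c' + of_bool ov) zs"
      using ys(1) c'(1) assms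
      by (simp add: Cons p v c'(2) part_val_def part_col_def part_ovl_def wcol_add_power)
    then show ?thesis unfolding Cons p v c'(2)
      using c'(1) by (intro UN_I[of "(c', ov)"]) auto
  qed
  show "?A = ?B \<union> ?C" using A B C(1) by blast
  show "?B \<inter> ?C = {}" using C(2) by blast
qed

section \<open>Removal of the last part, in terms of operators\<close>

lemma app_S_op_power: "app (S_op ^ n) f m = f (m + n)"
  by (induction n arbitrary: m) (simp_all add: app_S_op power_Suc)

text \<open>The colours with largest primary colour \<open>i + 1\<close> are the \<open>2 ^ i + c\<close> with \<open>c < 2 ^ i\<close>.\<close>

definition lead_gf :: "nat \<Rightarrow> nat \<Rightarrow> series" where
  "lead_gf r i = (\<Sum>c<2 ^ i. app (mono_op (col_weight c) * S_op ^ wcol r c) (seq_gf r (vcol r (2 ^ i + c) - 1)))"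

lemma sum_apply: "(\<Sum>i\<in>I. f i) x = (\<Sum>i\<in>I. f i x :: 'b::comm_monoid_add)"
  by (induction I rule: infinite_finite_induct) auto

text \<open>\<open>okseq_split\<close> in operator form: \<open>u_op i\<close> stands for the
  largest primary colour and \<open>Y_op\<close> for value and overline; inside
  \<open>lead_gf\<close>, the other primary colours give \<open>col_weight c\<close> and raise the
  bound by \<open>wcol r c\<close>.\<close>

lemma seq_gf_diff:
  assumes "i < r"
  shows "seq_gf r i - seq_gf r (Suc i) = app (u_op i * Y_op) (lead_gf r i)"
proof
  fix m
  let ?F = "\<lambda>(c, ov). (#) (m, 2 ^ i + c, ov) `
       {ys. okseq r (vcol r (2 ^ i + c)) (m + wcol r c + of_bool ov) ys}"
  let ?m = "\<lambda>s. if s = Size then m else 0"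
  have lt: "2 ^ i + c < 2 ^ r" if "c < 2 ^ i" for c :: nat
    using that power_increasing[of "Suc i" r "2::nat"] assms by auto
  have fin: "finite_fibres seq_weight ({ys. okseq r (Suc (Suc i)) m ys} \<union> (\<Union>co\<in>{..<2 ^ i} \<times> UNIV. ?F co))"
    using finite_fibres_okseq[of r "Suc i" m] unfolding okseq_split(1)[OF assms] .
  have "seq_gf r i m = seq_gf r (Suc i) m + gf seq_weight (\<Union>co\<in>{..<2 ^ i} \<times> UNIV. ?F co)"
    unfolding seq_gf_def okseq_split(1)[OF assms] by (rule gf_Un[OF fin okseq_split(2)[OF assms]])
  also have "gf seq_weight (\<Union>co\<in>{..<2 ^ i} \<times> UNIV. ?F co) = (\<Sum>co\<in>{..<2 ^ i} \<times> UNIV. gf seq_weight (?F co))"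
    by (rule gf_UN) (auto intro: finite_fibres_subset[OF fin])
  also have "\<dots> = (\<Sum>c<2 ^ i. \<Sum>ov\<in>UNIV. gf seq_weight (?F (c, ov)))"
    unfolding sum.cartesian_product by (rule sum.cong[OF refl]) clarsimp
  also have "\<dots> = (\<Sum>c<2 ^ i. app (u_op i * Y_op * (mono_op (col_weight c) * S_op ^ wcol r c))
      (seq_gf r (vcol r (2 ^ i + c) - 1)) m)"
  proof (rule sum.cong[OF refl])
    fix c :: nat
    assume "c \<in> {..<2 ^ i}"
    then have c: "c < 2 ^ i" by simp
    let ?a = "seq_gf r (vcol r (2 ^ i + c) - 1)"
    have F: "gf seq_weight (?F (c, ov)) = shift (unit_weight (Prim i) + (?m + ((if ov then 0 else unit_weight Plain)
        + col_weight c))) (?a (m + wcol r c + of_bool ov))" for ov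
    proof -
      have "part_weight eps (m, 2 ^ i + c, ov) = unit_weight (Prim i) + (?m + ((if ov then 0 else unit_weight Plain)
        + col_weight c))"
      proof
        fix s
        show "part_weight eps (m, 2 ^ i + c, ov) s = (unit_weight (Prim i) + (?m + ((if ov then 0 else unit_weight Plain)
          + col_weight c))) s"
          using eps_small[OF c order_refl]
          by (cases s) (auto simp: part_weight_def part_val_def part_col_def part_ovl_def unit_weight_def
              col_weight_def eps_add_power[OF c])
      qed
      then show ?thesis
        using lt[OF c] unfolding prod.case by (subst gf_image) (auto simp: seq_gf_vcol)
    qed
    have R: "app (u_op i * Y_op * (mono_op (col_weight c) * S_op ^ wcol r c)) ?a m
      = shift (unit_weight (Prim i)) (shift ?m (shift (unit_weight Plain) (shift (col_weight c) (?a (m + wcol r c)))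
        + shift (col_weight c) (?a (Suc m + wcol r c))))"
      by (simp add: Y_op_def app_mono_op app_X_op app_S_op app_S_op_power)
    show "(\<Sum>ov\<in>UNIV. gf seq_weight (?F (c, ov))) = app (u_op i * Y_op * (mono_op (col_weight c) * S_op ^ wcol r c)) ?a m"
      unfolding R F UNIV_bool shift_add shift_shift by (simp add: add.assoc del: plus_fun_apply)
  qed
  also have "\<dots> = app (u_op i * Y_op) (lead_gf r i) m"
    unfolding lead_gf_def app_sum sum_apply by simp
  finally show "(seq_gf r i - seq_gf r (Suc i)) m = app (u_op i * Y_op) (lead_gf r i) m"
    by (simp only: minus_apply add_diff_cancel_left')
qed

lemma mono_op_0: "mono_op (\<lambda>s. 0) = 1"
  by transfer (simp add: shift_0)

lemma lead_gf_0: "0 < r \<Longrightarrow> lead_gf r 0 = seq_gf r 0"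
  using vcol_power[of 0 r]
  by (simp add: lead_gf_def col_weight_0 mono_op_0 wcol_def prim_cols_0)

text \<open>The lower digits \<open>c\<close> are split by whether digit \<open>i\<close> is set. If
  it is, removing it gives a factor \<open>u_op i * S_op\<close>. If not, the smallest primary
  colour is the same as in \<open>lead_gf r i\<close>, except for \<open>c = 0\<close>, which
  accounts for the correction in brackets.\<close>

lemma lead_gf_Suc:
  assumes "Suc i < r"
  shows "lead_gf r (Suc i) = lead_gf r i + app (u_op i * S_op) (lead_gf r i) + (seq_gf r (Suc i) - seq_gf r i)"
proof -
  let ?T = "\<lambda>c. mono_op (col_weight c) * S_op ^ wcol r c"
  let ?f = "\<lambda>c. app (?T c) (seq_gf r (vcol r (2 ^ Suc i + c) - 1))"
  let ?g = "\<lambda>c. app (?T c) (seq_gf r (vcol r (2 ^ i + c) - 1))"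
  have i: "i < r" using assms by simp
  have pos: "(0::nat) < 2 ^ i" by simp
  have split: "{..<2 ^ Suc i} = {..<2 ^ i} \<union> (+) (2 ^ i) ` {..<(2::nat) ^ i}"
  proof
    show "{..<2 ^ Suc i} \<subseteq> {..<2 ^ i} \<union> (+) (2 ^ i) ` {..<(2::nat) ^ i}"
    proof
      fix c :: nat assume "c \<in> {..<2 ^ Suc i}"
      then have "c < 2 ^ i \<or> c = 2 ^ i + (c - 2 ^ i) \<and> c - 2 ^ i < 2 ^ i" by auto
      then show "c \<in> {..<2 ^ i} \<union> (+) (2 ^ i) ` {..<2 ^ i}" by blast
    qed
  qed auto
  have "lead_gf r (Suc i) = sum ?f {..<2 ^ i} + sum ?f ((+) (2 ^ i) ` {..<2 ^ i})"
    unfolding lead_gf_def split by (rule sum.union_disjoint) auto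
  also have "sum ?f ((+) (2 ^ i) ` {..<2 ^ i}) = (\<Sum>c<2 ^ i. ?f (2 ^ i + c))"
    by (subst sum.reindex) (simp_all only: o_def inj_on_add)
  also have "\<dots> = (\<Sum>c<2 ^ i. app (u_op i * S_op) (?g c))"
  proof (rule sum.cong[OF refl])
    fix c :: nat assume "c \<in> {..<2 ^ i}"
    then have c: "c < 2 ^ i" by simp
    have v: "vcol r (2 ^ Suc i + (2 ^ i + c)) = vcol r (2 ^ i + c)"
      by (rule vcol_add_power) (use c assms in auto)
    have T: "?T (2 ^ i + c) = u_op i * S_op * ?T c"
    proof -
      have "?T (2 ^ i + c) = u_op i * (mono_op (col_weight c) * S_op) * S_op ^ wcol r c"
        by (simp only: col_weight_add_power[OF c] wcol_add_power[OF c i] mono_op_mult[symmetric] power_Suc mult.assoc)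
      then show ?thesis by (simp only: mono_op_S[of "col_weight c"] mult.assoc)
    qed
    show "?f (2 ^ i + c) = app (u_op i * S_op) (?g c)"
      unfolding v T by (simp only: app_simps)
  qed
  also have "\<dots> = app (u_op i * S_op) (lead_gf r i)"
    by (simp only: lead_gf_def app_sum)
  also have "sum ?f {..<2 ^ i} = lead_gf r i + (seq_gf r (Suc i) - seq_gf r i)"
  proof -
    have ins: "{..<(2::nat) ^ i} = insert 0 {1..<2 ^ i}" using pos by auto
    have eq: "sum ?f {1..<2 ^ i} = sum ?g {1..<2 ^ i}"
    proof (rule sum.cong[OF refl])
      fix c :: nat assume c: "c \<in> {1..<2 ^ i}"
      then have "c < 2 ^ Suc i" by simp
      then have "vcol r (2 ^ Suc i + c) = vcol r c" using c assms by (intro vcol_add_power) auto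
      moreover have "vcol r (2 ^ i + c) = vcol r c" using c i by (intro vcol_add_power) auto
      ultimately show "?f c = ?g c" by (simp only:)
    qed
    have zero: "?T 0 = 1" by (simp add: col_weight_0 mono_op_0 wcol_def prim_cols_0)
    have f0: "?f 0 = seq_gf r (Suc i)" and g0: "?g 0 = seq_gf r i"
      using vcol_power[OF assms] vcol_power[OF i] by (simp_all only: zero app_simps add_0_right diff_Suc_1)
    have "sum ?f {..<2 ^ i} = seq_gf r (Suc i) + sum ?f {1..<2 ^ i}"
      unfolding ins by (subst sum.insert) (simp_all only: f0 finite_atLeastLessThan, auto)
    moreover have "lead_gf r i = seq_gf r i + sum ?g {1..<2 ^ i}"
      unfolding lead_gf_def ins by (subst sum.insert) (simp_all only: g0 finite_atLeastLessThan, auto)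
    ultimately show ?thesis unfolding eq by (metis (no_types, lifting) add.commute add_diff_cancel_left' add_diff_eq)
  qed
  finally show ?thesis by (simp only: add.assoc add.commute add.left_commute)
qed

text \<open>By \<open>seq_gf_diff\<close> the correction in \<open>lead_gf_Suc\<close> is
  \<open>- u_op i * Y_op\<close> applied to \<open>lead_gf r i\<close>. Together with
  \<open>u_op i * S_op\<close> it makes \<open>u_op i * L_op\<close>, so each step contributes one
  factor.\<close>

lemma lead_gf_eq:
  assumes "i < r"
  shows "lead_gf r i = app (prod_op u_op L_op i) (seq_gf r 0)"
  using assms
proof (induction i)
  case 0
  then show ?case by (simp add: lead_gf_0)
next
  case (Suc i)
  have "seq_gf r (Suc i) - seq_gf r i = - app (u_op i * Y_op) (lead_gf r i)"
    using seq_gf_diff[of i r] Suc.prems by (metis Suc_lessD minus_diff_eq)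
  then have "lead_gf r (Suc i) = app (1 + u_op i * S_op - u_op i * Y_op) (lead_gf r i)"
    unfolding lead_gf_Suc[OF Suc.prems] app_simps by (simp only: add_uminus_conv_diff)
  also have "1 + u_op i * S_op - u_op i * Y_op = 1 + u_op i * L_op"
    by (simp add: L_op_def algebra_simps)
  also have "lead_gf r i = app (prod_op u_op L_op i) (seq_gf r 0)" using Suc by simp
  also have "app (1 + u_op i * L_op) (app (prod_op u_op L_op i) (seq_gf r 0))
      = app ((1 + u_op i * L_op) * prod_op u_op L_op i) (seq_gf r 0)" by (simp only: app_simps)
  also have "(1 + u_op i * L_op) * prod_op u_op L_op i = prod_op u_op L_op (Suc i)"
  proof -
    have "prod_op u_op L_op i * (1 + u_op i * L_op) = (1 + u_op i * L_op) * prod_op u_op L_op i"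
    proof (rule prod_op_commute)
      show "u_op j * (1 + u_op i * L_op) = (1 + u_op i * L_op) * u_op j" for j
        unfolding distrib_left distrib_right
        by (simp only: mult_1 mult_1_right mult.assoc mono_op_L[symmetric]) (simp only: mult.assoc[symmetric] u_op_commute)
      show "L_op * (1 + u_op i * L_op) = (1 + u_op i * L_op) * L_op"
        unfolding distrib_left distrib_right
        by (simp only: mult_1 mult_1_right mult.assoc mono_op_L)
    qed
    then show ?thesis by simp
  qed
  finally show ?case .
qed

text \<open>The differences in \<open>seq_gf_diff\<close> telescope from \<open>i = 0\<close> to
  \<open>i = r\<close>, and by \<open>lead_gf_eq\<close> they add up to
  \<open>quot_op\<close>.\<close>

lemma seq_gf_eq: "seq_gf r 0 - app S_op (seq_gf r 0) = app (Y_op * quot_op u_op L_op r) (seq_gf r 0)"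
proof -
  let ?a = "seq_gf r 0"
  have "?a - seq_gf r i = app (Y_op * quot_op u_op L_op i) ?a" if "i \<le> r" for i
    using that
  proof (induction i)
    case (Suc i)
    have "?a - seq_gf r (Suc i) = (?a - seq_gf r i) + (seq_gf r i - seq_gf r (Suc i))"
      by (simp only: diff_add_cancel add_diff_eq)
    also have "\<dots> = app (Y_op * quot_op u_op L_op i + u_op i * Y_op * prod_op u_op L_op i) ?a"
      using Suc seq_gf_diff[of i r] lead_gf_eq[of i r] by (simp only: app_simps Suc_le_eq Suc_leD less_imp_le)
    also have "u_op i * Y_op * prod_op u_op L_op i = Y_op * (u_op i * prod_op u_op L_op i)"
      by (simp only: mono_op_Y mult.assoc)
    finally show ?case by (simp only: quot_op.simps distrib_left)
  qed simp
  \<comment> \<open>The constraint \<open>v = r + 1\<close> exceeds every \<open>z(c)\<close> and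
    always adds 1 to the bound, whereas \<open>v = 1\<close> never does.\<close>
  moreover have "seq_gf r r = app S_op ?a"
  proof
    fix m
    have "okseq r (Suc r) m ys \<longleftrightarrow> okseq r (Suc 0) (Suc m) ys" for ys
    proof (cases ys)
      case (Cons p ps)
      then show ?thesis
        using col_bounds(3,4)[of "part_col p" r] by (auto simp: of_bool_def split: if_splits)
    qed simp
    then show "seq_gf r r m = app S_op ?a m" by (simp add: seq_gf_def app_S_op)
  qed
  ultimately show ?thesis by force
qed

lemma weight_0_iff: "(0 :: weight) = x \<longleftrightarrow> (\<forall>s. x s = 0)"
  by (auto simp: fun_eq_iff)

lemma gf_singleton_0:
  assumes "\<And>s. s \<in> A \<Longrightarrow> wt s = x \<Longrightarrow> s = z" "z \<in> A" "wt z = 0"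
  shows "gf wt A x = (if \<forall>s. x s = 0 then 1 else 0)"
proof -
  have "{s \<in> A. wt s = x} = (if \<forall>s. x s = 0 then {z} else {})"
  proof (cases "\<forall>s. x s = 0")
    case True
    then have "x = wt z" using assms(3) weight_0_iff[of x] by simp
    then have "{s \<in> A. wt s = x} = {z}" using assms(1,2) by blast
    then show ?thesis by (simp only: True simp_thms if_True)
  next
    case False
    then have "wt z \<noteq> x" using assms(3) weight_0_iff[of x] by simp
    then have "{s \<in> A. wt s = x} = {}" using assms(1) by blast
    then show ?thesis by (simp only: if_not_P[OF False])
  qed
  then show ?thesis by (simp add: gf_def)
qed

lemma seq_gf_large:
  assumes "x Size < m"
  shows "seq_gf r 0 m x = (if \<forall>s. x s = 0 then 1 else 0)"
  unfolding seq_gf_def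
proof (rule gf_singleton_0)
  show "ys = []" if "ys \<in> {ys. okseq r (Suc 0) m ys}" "seq_weight ys = x" for ys
    using okseq_parts(3)[of r "Suc 0" m ys] that assms by auto
qed simp_all

lemma seq_gf_deg_0:
  assumes "deg r x = 0"
  shows "seq_gf r 0 m x = (if \<forall>s. x s = 0 then 1 else 0)"
  unfolding seq_gf_def
proof (rule gf_singleton_0)
  show "ys = []" if "ys \<in> {ys. okseq r (Suc 0) m ys}" "seq_weight ys = x" for ys
    using okseq_parts(2)[of r "Suc 0" m ys] that assms by auto
qed simp_all

lemma seq_gf_functional_equation:
  "app (prod_op u_op (- d_op) r) (seq_gf r 0) 0 = app (prod_op u_op 1 r * sigma_op r) (seq_gf r 0) 0"
  by (intro functional_equation_at_0 functional_equation seq_gf_eq seq_gf_large)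

section \<open>Overpartitions\<close>

definition mset_weight :: "cpart multiset \<Rightarrow> weight" where
  "mset_weight M s = (\<Sum>p\<in>#M. part_weight (=) p s)"

lemma mset_weight_add: "mset_weight (add_mset p M) = part_weight (=) p + mset_weight M"
  by (simp add: mset_weight_def fun_eq_iff)

definition overpartitions :: "nat \<Rightarrow> cpart multiset set" where
  "overpartitions r = {M. (\<forall>p \<in># M. part_col p \<in> {1..r}) \<and> (\<forall>v c. count M (v, c, True) \<le> 1)}"

text \<open>Interpolates between all overpartitions at \<open>i = 0\<close> and those without parts
  equal to 0 at \<open>i = r\<close>, so that zero parts can be removed one colour at a
  time.\<close>

definition overpartitions0 :: "nat \<Rightarrow> nat \<Rightarrow> cpart multiset set" where
  "overpartitions0 r i = {M \<in> overpartitions r. \<forall>p \<in># M. part_val p = 0 \<longrightarrow> i < part_col p}"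

lemma overpartitions0_0: "overpartitions0 r 0 = overpartitions r"
  by (auto simp: overpartitions0_def overpartitions_def)

lemma deg_mset_weight:
  "(\<And>p. p \<in># M \<Longrightarrow> part_col p \<in> {1..r}) \<Longrightarrow> deg r (mset_weight M) = size M"
proof (induction M)
  case empty
  show ?case by (simp add: mset_weight_def deg_def)
next
  case (add p M)
  have p: "part_col p \<in> {1..r}" using add.prems by simp
  have "deg r (part_weight (=) p) = (\<Sum>j<r. if j = part_col p - 1 then 1 else 0)"
    unfolding deg_def using p by (intro sum.cong) (auto simp: part_weight_def)
  also have "\<dots> = 1" using p by auto
  finally show ?case using add by (simp only: mset_weight_add deg_add) simp
qed

lemma part_val_le_mset_weight: "p \<in># M \<Longrightarrow> part_val p \<le> mset_weight M Size"
  by (induction M) (auto simp: mset_weight_def part_weight_def)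

lemma finite_fibres_overpartitions: "finite_fibres mset_weight (overpartitions r)"
  unfolding finite_fibres_def
proof
  fix x
  have "{M \<in> overpartitions r. mset_weight M = x} \<subseteq> multisets_of_size ({..x Size} \<times> {1..r} \<times> UNIV) (deg r x)"
  proof
    fix M assume "M \<in> {M \<in> overpartitions r. mset_weight M = x}"
    then have M: "\<And>p. p \<in># M \<Longrightarrow> part_col p \<in> {1..r}" "mset_weight M = x"
      by (auto simp: overpartitions_def)
    have "set_mset M \<subseteq> {..x Size} \<times> {1..r} \<times> UNIV"
    proof
      fix p assume "p \<in># M"
      then show "p \<in> {..x Size} \<times> {1..r} \<times> UNIV"
        using M(1)[of p] part_val_le_mset_weight[of p M] M(2)
        by (cases p) (auto simp: part_val_def part_col_def)
    qed
    then show "M \<in> multisets_of_size ({..x Size} \<times> {1..r} \<times> UNIV) (deg r x)"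
      using deg_mset_weight[of M r] M by (simp add: multisets_of_size_def)
  qed
  then show "finite {M \<in> overpartitions r. mset_weight M = x}"
    by (rule finite_subset) (intro finite_multisets_of_size finite_SigmaI; simp)
qed

text \<open>Constant in \<open>m\<close>; the argument is present only so that the operators on
  \<open>series\<close> apply.\<close>

definition mset_gf :: "nat \<Rightarrow> nat \<Rightarrow> series" where
  "mset_gf r i m = gf mset_weight (overpartitions0 r i)"

text \<open>Zero parts of colour \<open>Suc i\<close> contribute \<open>(1 + u) / (1 - u d)\<close>:
  any number of non-overlined ones and at most one overlined. Splitting off one copy of
  \<open>?p\<close> gives the left factor, and splitting \<open>E\<close> by the presence of
  \<open>?t\<close> gives the right one.\<close>

lemma mset_gf_step:
  assumes "i < r"
  shows "app (1 - u_op i * d_op) (mset_gf r i) = app (1 + u_op i) (mset_gf r (Suc i))"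
proof
  fix m
  let ?A = "overpartitions0 r i" and ?A' = "overpartitions0 r (Suc i)"
  let ?p = "(0, Suc i, False)" and ?t = "(0, Suc i, True)"
  define E where "E = {M \<in> ?A. ?p \<notin># M}"
  have fin: "finite_fibres mset_weight B" if "B \<subseteq> ?A" for B
    using that by (intro finite_fibres_subset[OF finite_fibres_overpartitions[of r]]) (auto simp: overpartitions0_def)
  have wp: "part_weight (=) ?p = unit_weight (Prim i) + unit_weight Plain"
    and wt: "part_weight (=) ?t = unit_weight (Prim i)"
    by (auto simp: fun_eq_iff part_weight_def unit_weight_def part_val_def part_col_def part_ovl_def split: stat.split)
  have memA: "M \<in> overpartitions0 r j \<longleftrightarrow> (\<forall>p \<in># M. part_col p \<in> {1..r} \<and> (part_val p = 0 \<longrightarrow> j < part_col p))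
      \<and> (\<forall>v c. count M (v, c, True) \<le> 1)" for M j
    by (simp only: overpartitions0_def overpartitions_def mem_Collect_eq ball_conj_distrib conj_ac)
  have add_p: "add_mset ?p M \<in> ?A \<longleftrightarrow> M \<in> ?A" for M
    unfolding memA using assms by (auto simp: part_col_def part_val_def)
  have A: "?A = E \<union> add_mset ?p ` ?A"
  proof
    show "?A \<subseteq> E \<union> add_mset ?p ` ?A"
    proof
      fix M assume M: "M \<in> ?A"
      show "M \<in> E \<union> add_mset ?p ` ?A"
      proof (cases "?p \<in># M")
        case True
        then obtain N where "M = add_mset ?p N" by (metis mset_add)
        then show ?thesis using M add_p by auto
      qed (use M in \<open>simp add: E_def\<close>)
    qed
  qed (use add_p in \<open>auto simp: E_def\<close>)
  have E: "E = ?A' \<union> add_mset ?t ` ?A'"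
  proof
    show "E \<subseteq> ?A' \<union> add_mset ?t ` ?A'"
    proof
      fix M assume M: "M \<in> E"
      have up: "N \<in> ?A'" if N: "N \<in> ?A" "?p \<notin># N" "?t \<notin># N" for N
      proof -
        have "Suc i < part_col q" if "q \<in># N" "part_val q = 0" for q
        proof -
          have "i < part_col q" using N(1) that unfolding memA by auto
          moreover have "part_col q \<noteq> Suc i"
            using that N(2,3) by (cases q; cases "part_ovl q") (auto simp: part_col_def part_val_def part_ovl_def)
          ultimately show ?thesis by simp
        qed
        then show ?thesis using N(1) unfolding memA by auto
      qed
      show "M \<in> ?A' \<union> add_mset ?t ` ?A'"
      proof (cases "?t \<in># M")
        case True
        then obtain N where N: "M = add_mset ?t N" by (metis mset_add)
        have M': "M \<in> ?A" "?p \<notin># M" using M by (auto simp: E_def)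
        have le: "count N q \<le> count M q" for q unfolding N by simp
        have "count M ?t \<le> 1" using M'(1) unfolding memA by blast
        then have "?t \<notin># N" unfolding N by (simp add: not_in_iff)
        moreover have "N \<in> ?A" using M'(1) le unfolding memA N
          by (metis (no_types, lifting) le_trans N insert_iff set_mset_add_mset_insert)
        moreover have "?p \<notin># N" using M'(2) N by simp
        ultimately show ?thesis using up N by blast
      qed (use M up in \<open>auto simp: E_def\<close>)
    qed
    show "?A' \<union> add_mset ?t ` ?A' \<subseteq> E"
    proof -
      have sub: "M \<in> ?A \<and> ?p \<notin># M \<and> ?t \<notin># M" if "M \<in> ?A'" for M
        using that unfolding memA by (fastforce simp: part_col_def part_val_def)
      have "add_mset ?t M \<in> ?A" if "M \<in> ?A" "?t \<notin># M" for M
        using that assms unfolding memA by (auto simp: part_col_def part_val_def not_in_iff)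
      then show ?thesis using sub by (auto simp: E_def)
    qed
  qed
  have t_notin: "?t \<notin># M" if "M \<in> ?A'" for M
    using that unfolding memA by (fastforce simp: part_col_def part_val_def)
  have "gf mset_weight ?A = gf mset_weight E + gf mset_weight (add_mset ?p ` ?A)"
    by (subst A, rule gf_Un) (use A fin in \<open>auto simp: E_def\<close>)
  also have "gf mset_weight (add_mset ?p ` ?A) = shift (unit_weight (Prim i) + unit_weight Plain) (gf mset_weight ?A)"
    by (rule gf_image) (simp_all only: mset_weight_add wp, simp add: inj_on_def)
  also have "gf mset_weight E = gf mset_weight ?A' + gf mset_weight (add_mset ?t ` ?A')"
    unfolding E
  proof (rule gf_Un)
    show "finite_fibres mset_weight (?A' \<union> add_mset ?t ` ?A')"
      using fin[of E] unfolding E[symmetric] by (simp add: E_def)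
    show "?A' \<inter> add_mset ?t ` ?A' = {}" by (auto dest: t_notin)
  qed
  also have "gf mset_weight (add_mset ?t ` ?A') = shift (unit_weight (Prim i)) (gf mset_weight ?A')"
    by (rule gf_image) (simp_all only: mset_weight_add wt, simp add: inj_on_def)
  finally have "gf mset_weight ?A - shift (unit_weight (Prim i) + unit_weight Plain) (gf mset_weight ?A)
      = gf mset_weight ?A' + shift (unit_weight (Prim i)) (gf mset_weight ?A')"
    by (metis add_diff_cancel_right')
  then show "app (1 - u_op i * d_op) (mset_gf r i) m = app (1 + u_op i) (mset_gf r (Suc i)) m"
    by (simp only: mono_op_mult app_simps minus_apply plus_fun_apply app_mono_op mset_gf_def)
qed

text \<open>Adding 1 to every part is a bijection from all overpartitions to those without zero
  parts. It raises \<open>Size\<close> by the number of parts, which is the degree.\<close>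

lemma mset_gf_shift: "mset_gf r r = app (sigma_op r) (mset_gf r 0)"
proof (intro ext)
  fix m x
  let ?h = "\<lambda>(v, c, ov). (Suc v, c, ov) :: cpart"
  let ?f = "image_mset ?h"
  let ?x = "x(Size := x Size - deg r x)"
  have inj_h: "inj ?h" by (auto simp: inj_def)
  have count_f: "count (?f M) (?h p) = count M p" for M p
    by (cases p, induction M) auto
  have f_mem: "?f M \<in> overpartitions0 r r" if "M \<in> overpartitions r" for M
  proof -
    have "count (?f M) (v, c, True) \<le> 1" for v c
    proof (cases v)
      case 0
      then have "(v, c, True) \<notin># ?f M" by auto
      then show ?thesis unfolding not_in_iff by linarith
    next
      case (Suc v')
      then show ?thesis using count_f[of M "(v', c, True)"] that by (simp add: overpartitions_def)
    qed
    then show ?thesis using that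
      by (auto simp: overpartitions0_def overpartitions_def part_col_def part_val_def)
  qed
  have f_weight: "mset_weight (?f M) s = (if s = Size then mset_weight M s + size M else mset_weight M s)" for M s
    by (induction M) (auto simp: mset_weight_def part_weight_def part_val_def part_col_def part_ovl_def split: stat.split)
  have f_surj: "\<exists>N \<in> overpartitions r. M = ?f N" if M: "M \<in> overpartitions0 r r" for M
  proof -
    \<comment> \<open>The truncated predecessor inverts \<open>?h\<close> on \<open>M\<close>, since
      a zero part would need a colour above \<open>r\<close>.\<close>
    let ?g = "\<lambda>(v, c, ov). (v - 1, c, ov) :: cpart"
    have "part_val p \<noteq> 0" if "p \<in># M" for p
      using M that by (fastforce simp: overpartitions0_def overpartitions_def)
    then have "?h (?g p) = p" if "p \<in># M" for p
      using that by (cases p) (fastforce simp: part_val_def)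
    then have fg: "?f (image_mset ?g M) = M"
      by (simp add: multiset.map_comp o_def cong: image_mset_cong)
    have "count (image_mset ?g M) (v, c, True) \<le> 1" for v c
    proof -
      have "count M (Suc v, c, True) \<le> 1"
        using M unfolding overpartitions0_def overpartitions_def by blast
      then show ?thesis using count_f[of "image_mset ?g M" "(v, c, True)"] unfolding fg by simp
    qed
    then have "image_mset ?g M \<in> overpartitions r"
      using M by (auto simp: overpartitions0_def overpartitions_def part_col_def)
    then show ?thesis using fg by metis
  qed
  have size: "size M = deg r (mset_weight M)" if "M \<in> overpartitions r" for M
    using deg_mset_weight[of M r] that by (auto simp: overpartitions_def)
  have deg_upd: "deg r (y(Size := k)) = deg r y" for y k by (simp add: deg_def)
  have weight_f: "mset_weight (?f M) = (mset_weight M)(Size := mset_weight M Size + deg r (mset_weight M))"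
    if "M \<in> overpartitions r" for M
    unfolding fun_eq_iff f_weight fun_upd_apply using size[OF that] by simp
  have deg_f: "deg r (mset_weight (?f M)) = deg r (mset_weight M)" if "M \<in> overpartitions r" for M
    using weight_f[OF that] deg_upd by metis
  show "mset_gf r r m x = app (sigma_op r) (mset_gf r 0) m x"
  proof (cases "deg r x \<le> x Size")
    case True
    have iff: "mset_weight (?f M) = x \<longleftrightarrow> mset_weight M = ?x" if M: "M \<in> overpartitions r" for M
    proof
      assume a: "mset_weight (?f M) = x"
      have x: "x = (mset_weight M)(Size := mset_weight M Size + deg r (mset_weight M))"
        by (rule trans[OF sym[OF a] weight_f[OF M]])
      show "mset_weight M = ?x"
        unfolding x deg_upd by (simp add: fun_eq_iff)
    next
      assume b: "mset_weight M = ?x"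
      show "mset_weight (?f M) = x"
        unfolding weight_f[OF M] b deg_upd using True by (simp add: fun_eq_iff)
    qed
    have "{M \<in> overpartitions0 r r. mset_weight M = x} = ?f ` {M \<in> overpartitions r. mset_weight M = ?x}"
      using f_mem f_surj iff by blast
    moreover have "inj_on ?f {M \<in> overpartitions r. mset_weight M = ?x}"
      using multiset.inj_map[OF inj_h] by (rule inj_on_subset) simp
    ultimately show ?thesis
      using True by (simp add: mset_gf_def gf_def app_sigma_op card_image overpartitions0_0)
  next
    case False
    have "mset_weight (?f M) \<noteq> x" if "M \<in> overpartitions r" for M
      using weight_f[OF that] deg_f[OF that] False by (metis fun_upd_same le_add2)
    then have "{M \<in> overpartitions0 r r. mset_weight M = x} = {}" using f_surj by blast
    then have "card {M \<in> overpartitions0 r r. mset_weight M = x} = 0" by (simp only: card.empty)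
    then show ?thesis using False by (simp add: mset_gf_def gf_def app_sigma_op)
  qed
qed

text \<open>\<open>mset_gf_step\<close> is iterated over the \<open>r\<close> colours until no zero
  parts are left; then \<open>mset_gf_shift\<close> returns to all overpartitions.\<close>

lemma mset_gf_functional_equation:
  "app (prod_op u_op (- d_op) r) (mset_gf r 0) = app (prod_op u_op 1 r * sigma_op r) (mset_gf r 0)"
proof -
  have "app (prod_op u_op (- d_op) n) (mset_gf r 0) = app (prod_op u_op 1 n) (mset_gf r n)" if "n \<le> r" for n
    using that
  proof (induction n)
    case (Suc n)
    let ?D = "prod_op u_op (- d_op) n" and ?C = "prod_op u_op 1 n" and ?e = "1 - u_op n * d_op"
    have comm: "prod_op u_op K n * ?e = ?e * prod_op u_op K n" if "K = 1 \<or> K = - d_op" for K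
    proof (rule prod_op_commute)
      have u: "mono_op w * ?e = ?e * mono_op w" for w
        by (simp add: left_diff_distrib right_diff_distrib mono_op_mult ac_simps)
      show "u_op i * ?e = ?e * u_op i" for i by (rule u)
      show "K * ?e = ?e * K" using that u by (auto)
    qed
    have "app (prod_op u_op (- d_op) (Suc n)) (mset_gf r 0) = app (?D * ?e) (mset_gf r 0)"
      by simp
    also have "\<dots> = app ?e (app ?D (mset_gf r 0))" using comm by (simp only: app_simps simp_thms)
    also have "\<dots> = app ?e (app ?C (mset_gf r n))" using Suc by simp
    also have "\<dots> = app ?C (app ?e (mset_gf r n))"
      by (metis app_simps(6) comm)
    also have "\<dots> = app ?C (app (1 + u_op n) (mset_gf r (Suc n)))"
      using mset_gf_step[of n r] Suc.prems by simp
    finally show ?case by simp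
  qed simp
  from this[of r] show ?thesis by (simp add: mset_gf_shift)
qed

lemma mset_gf_deg_0:
  assumes "deg r x = 0"
  shows "mset_gf r 0 m x = (if \<forall>s. x s = 0 then 1 else 0)"
  unfolding mset_gf_def overpartitions0_0
proof (rule gf_singleton_0)
  show "M = {#}" if "M \<in> overpartitions r" "mset_weight M = x" for M
    using deg_mset_weight[of M r] that assms by (auto simp: overpartitions_def)
qed (auto simp: overpartitions_def mset_weight_def)

lemma mset_gf_eq_seq_gf: "mset_gf r 0 0 = seq_gf r 0 0"
  by (rule functional_equation_unique[of r])
    (simp_all only: mset_gf_functional_equation seq_gf_functional_equation mset_gf_deg_0 seq_gf_deg_0)

section \<open>The two counts\<close>

text \<open>Exponents from index \<open>r\<close> on are set to 0, because weights are functions on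
  all indices while \<open>l\<close> is arbitrary outside \<open>{1..r}\<close>.\<close>

definition target :: "nat \<Rightarrow> (nat \<Rightarrow> nat) \<Rightarrow> nat \<Rightarrow> nat \<Rightarrow> weight" where
  "target r l k n s = (case s of Prim j \<Rightarrow> if j < r then l (Suc j) else 0 | Plain \<Rightarrow> k | Size \<Rightarrow> n)"

lemma eq_target_iff:
  assumes "\<And>j. r \<le> j \<Longrightarrow> x (Prim j) = 0"
  shows "x = target r l k n \<longleftrightarrow> (\<forall>i\<in>{1..r}. x (Prim (i - 1)) = l i) \<and> x Plain = k \<and> x Size = n"
proof
  assume "x = target r l k n"
  then show "(\<forall>i\<in>{1..r}. x (Prim (i - 1)) = l i) \<and> x Plain = k \<and> x Size = n"
    by (auto simp: target_def)
next
  assume x: "(\<forall>i\<in>{1..r}. x (Prim (i - 1)) = l i) \<and> x Plain = k \<and> x Size = n"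
  show "x = target r l k n"
  proof
    fix s
    show "x s = target r l k n s"
    proof (cases s)
      case (Prim j)
      have "j < r \<Longrightarrow> x (Prim j) = l (Suc j)" using x by (auto dest: bspec[of _ _ "Suc j"])
      then show ?thesis using assms[of j] by (simp add: Prim target_def)
    qed (use x in \<open>simp_all add: target_def\<close>)
  qed
qed

lemma mset_weight_simps:
  "mset_weight M (Prim j) = size (filter_mset (\<lambda>p. part_col p = Suc j) M)"
  "mset_weight M Plain = size (filter_mset (\<lambda>p. \<not> part_ovl p) M)"
  "mset_weight M Size = sum_mset (image_mset part_val M)"
  by (induction M) (auto simp: mset_weight_def part_weight_def)

lemma seq_weight_simps:
  "seq_weight ys (Prim j) = length (filter (\<lambda>p. eps (Suc j) (part_col p)) ys)"
  "seq_weight ys Plain = length (filter (\<lambda>p. \<not> part_ovl p) ys)"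
  "seq_weight ys Size = sum_list (map part_val ys)"
  by (induction ys) (auto simp: part_weight_def)

lemma Abar_eq: "int (Abar r l k n) = mset_gf r 0 0 (target r l k n)"
proof -
  have "mset_weight M = target r l k n \<longleftrightarrow> sum_mset (image_mset part_val M) = n
    \<and> (\<forall>i \<in> {1..r}. size (filter_mset (\<lambda>p. part_col p = i) M) = l i)
    \<and> size (filter_mset (\<lambda>p. \<not> part_ovl p) M) = k" if "M \<in> overpartitions r" for M
  proof -
    have "mset_weight M (Prim j) = 0" if "r \<le> j" for j
    proof -
      have "part_col p \<noteq> Suc j" if "p \<in># M" for p
        using \<open>M \<in> overpartitions r\<close> \<open>r \<le> j\<close> that by (fastforce simp: overpartitions_def)
      then have "filter_mset (\<lambda>p. part_col p = Suc j) M = filter_mset (\<lambda>p. False) M"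
        by (intro filter_mset_cong0) simp
      then show ?thesis by (simp add: mset_weight_simps)
    qed
    then show ?thesis by (subst eq_target_iff) (auto simp: mset_weight_simps)
  qed
  then have "{M \<in> overpartitions r. mset_weight M = target r l k n} = {M \<in> overpartitions r.
      sum_mset (image_mset part_val M) = n
    \<and> (\<forall>i \<in> {1..r}. size (filter_mset (\<lambda>p. part_col p = i) M) = l i)
    \<and> size (filter_mset (\<lambda>p. \<not> part_ovl p) M) = k}" by blast
  then show ?thesis
    unfolding mset_gf_def gf_def overpartitions0_0 Abar_def overpartitions_def mem_Collect_eq by (simp only: conj_assoc)
qed

text \<open>Keeps the integer form of the condition in \<open>Bbar\<close>, so that unfolding
  matches that definition literally.\<close>

definition gap :: "nat \<Rightarrow> cpart \<Rightarrow> cpart \<Rightarrow> bool" where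
  "gap r p p' \<longleftrightarrow> int (part_val p) - int (part_val p')
     \<ge> int (wcol r (part_col p')) + (if part_ovl p' then 1 else 0) - 1 + delta r (part_col p) (part_col p')"

lemma successively_conv_nth: "successively P xs \<longleftrightarrow> (\<forall>i. i + 1 < length xs \<longrightarrow> P (xs ! i) (xs ! (i + 1)))"
proof (induction P xs rule: successively.induct)
  case (3 P x y xs)
  have all: "(\<forall>i. Q i) \<longleftrightarrow> Q 0 \<and> (\<forall>i. Q (Suc i))" for Q :: "nat \<Rightarrow> bool"
    by (metis nat.exhaust)
  have "(\<forall>i. i + 1 < length (x # y # xs) \<longrightarrow> P ((x # y # xs) ! i) ((x # y # xs) ! (i + 1)))
    \<longleftrightarrow> P x y \<and> (\<forall>i. i + 1 < length (y # xs) \<longrightarrow> P ((y # xs) ! i) ((y # xs) ! (i + 1)))"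
    by (subst all) simp
  then show ?case using 3 by simp
qed auto

lemma okseq_iff:
  "okseq r v m ys \<longleftrightarrow> (\<forall>p\<in>set ys. part_col p \<in> {1..2 ^ r - 1})
     \<and> (ys \<noteq> [] \<longrightarrow> m + of_bool (zcol r (part_col (hd ys)) < v) \<le> part_val (hd ys))
     \<and> successively (\<lambda>p' p. gap r p p') ys"
proof (induction ys arbitrary: v m)
  case (Cons p ps)
  have col: "part_col q \<in> {1..2 ^ r - 1} \<longleftrightarrow> 0 < part_col q \<and> part_col q < 2 ^ r" for q
  proof -
    have "(0::nat) < 2 ^ r" by simp
    then show ?thesis by (auto simp del: zero_less_power)
  qed
  \<comment> \<open>\<open>wcol\<close> is at least 1 for a genuine colour, so the truncated
    \<open>wcol - 1\<close> agrees with the integer expression in \<open>gap\<close>.\<close>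
  have key: "part_val p + (wcol r (part_col p) - 1) + of_bool (part_ovl p)
       + of_bool (zcol r (part_col q) < vcol r (part_col p)) \<le> part_val q \<longleftrightarrow> gap r q p"
    if "0 < part_col p" "part_col p < 2 ^ r" for q
    using col_bounds(1)[OF that] by (auto simp: gap_def delta_def of_bool_def)
  show ?case
  proof (cases "0 < part_col p \<and> part_col p < 2 ^ r")
    case True
    moreover have "ps = [] \<Longrightarrow> successively (\<lambda>p' p. gap r p p') ps" "p # ps \<noteq> []" by simp_all
    ultimately show ?thesis
      unfolding okseq.simps Cons.IH successively_Cons list.set ball_simps col list.sel
      using key[of "hd ps"] by blast
  next
    case False
    then show ?thesis unfolding okseq.simps list.set ball_simps col by blast
  qed
qed simp

lemma Bbar_eq: "int (Bbar r l k n) = seq_gf r 0 0 (target r l k n)"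
proof -
  have ok: "okseq r (Suc 0) 0 (rev xs) \<longleftrightarrow> (\<forall>p \<in> set xs. part_col p \<in> {1..2 ^ r - 1})
      \<and> (\<forall>i. i + 1 < length xs \<longrightarrow> gap r (xs ! i) (xs ! (i + 1)))" for xs
  proof -
    \<comment> \<open>Every \<open>z(c)\<close> is at least 1, so the initial constraint
      \<open>v = 1\<close>, \<open>m = 0\<close> imposes nothing on the last part.\<close>
    have "zcol r (part_col (hd (rev xs))) \<ge> 1" if "xs \<noteq> []" "\<forall>p \<in> set xs. part_col p \<in> {1..2 ^ r - 1}"
    proof -
      have "hd (rev xs) \<in> set xs" using that(1) by (metis hd_in_set rev_is_Nil_conv set_rev)
      then have "part_col (hd (rev xs)) \<in> {1..2 ^ r - 1}" using that(2) by blast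
      moreover have "(0::nat) < 2 ^ r" by simp
      ultimately show ?thesis by (intro col_bounds(3)) auto
    qed
    then show ?thesis
      unfolding okseq_iff successively_rev successively_conv_nth[symmetric] by auto
  qed
  have wt: "seq_weight (rev xs) = target r l k n \<longleftrightarrow> sum_list (map part_val xs) = n
    \<and> (\<forall>i \<in> {1..r}. length (filter (\<lambda>p. eps i (part_col p)) xs) = l i)
    \<and> length (filter (\<lambda>p. \<not> part_ovl p) xs) = k" if "\<forall>p \<in> set xs. part_col p \<in> {1..2 ^ r - 1}" for xs
  proof -
    have "seq_weight (rev xs) (Prim j) = 0" if "r \<le> j" for j
    proof -
      have "\<not> eps (Suc j) (part_col p)" if "p \<in> set xs" for p
      proof (rule eps_small[OF _ \<open>r \<le> j\<close>])
        have "part_col p \<le> 2 ^ r - 1" "(0::nat) < 2 ^ r"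
          using \<open>\<forall>p \<in> set xs. part_col p \<in> {1..2 ^ r - 1}\<close> that by auto
        then show "part_col p < 2 ^ r" by linarith
      qed
      then show ?thesis by (simp add: seq_weight_simps filter_empty_conv flip: rev_filter)
    qed
    then show ?thesis
      by (subst eq_target_iff) (auto simp: seq_weight_simps simp flip: rev_filter rev_map)
  qed
  have "{ys \<in> {ys. okseq r (Suc 0) 0 ys}. seq_weight ys = target r l k n} = rev ` {xs.
      (\<forall>p \<in> set xs. part_col p \<in> {1..2 ^ r - 1})
    \<and> sum_list (map part_val xs) = n
    \<and> (\<forall>i \<in> {1..r}. length (filter (\<lambda>p. eps i (part_col p)) xs) = l i)
    \<and> length (filter (\<lambda>p. \<not> part_ovl p) xs) = k
    \<and> (\<forall>i. i + 1 < length xs \<longrightarrow> gap r (xs ! i) (xs ! (i + 1)))}" (is "?L = rev ` ?R")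
  proof -
    have "rev xs \<in> ?L \<longleftrightarrow> xs \<in> ?R" for xs using ok[of xs] wt[of xs] by blast
    then show ?thesis by (metis (no_types, lifting) image_eqI rev_rev_ident subsetI subset_antisym image_subsetI)
  qed
  then show ?thesis
    unfolding seq_gf_def gf_def Bbar_def gap_def by (simp only: card_image[OF inj_on_subset[OF inj_on_rev subset_UNIV]])
qed

theorem theorem2p7:
  fixes r k n :: nat and l :: "nat \<Rightarrow> nat"
  assumes "r \<ge> 1"
  shows "Abar r l k n = Bbar r l k n"
  using Abar_eq[of r l k n] Bbar_eq[of r l k n] by (simp add: mset_gf_eq_seq_gf)

end
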